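(* Let $k>0$, $A\in\Lambda^{1}(U,\mathrm{End}(V))$, $J\in\Lambda^{k+1}(U,V)$, and let $J_{e}:=dHJ$ and $J_{a}:=HdJ$ be the exact and antiexact parts of $J$. The solution $\phi\in\Lambda^{k}(U,V)$ of the inhomogeneous covariant constancy equation $$d^{\nabla}\phi=J,\qquad d^{\nabla}=d+A\wedge\_,$$ is given by $\phi=\phi_{1}+\phi_{2}+\phi_{3}$, where: - $\phi_{1}$ fulfils $d^{\nabla}\phi_{1}=J_{e}-d(\phi_{2}+\phi_{3})$; - $\phi_{2}$ fulfils $A\wedge\phi_{2}=J_{a}$; - $\phi_{3}\in\ker(A\wedge\_)$ is an arbitrary choice. Moreover, $A\wedge\phi_{1}\in\mathcal{E}^{k+1}(U,V)$ and $A\wedge\phi_{2}\in\mathcal{A}^{k+1}(U,V)$. If these equations cannot be solved, then there is no solution of $d^{\nabla}\phi=J$. The only equation that imposes a constraint is $A\wedge\phi_{2}=J_{a}$, and it can be fulfilled only when $J_{a}\in\mathrm{Im}(A\wedge\_)$.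
   Context: $U\subset\mathbb{R}^{n}$ is a bounded open set, star-shaped with respect to a point $x_{0}\in U$; $V$ is a finite-dimensional real vector space. $\Lambda^{k}(U,V)$ denotes $V$-valued differential $k$-forms on $U$. $A$ is a smooth $\mathrm{End}(V)$-valued one-form (assumed of constant rank), and $A\wedge\_$ is the operator $\omega\mapsto A\wedge\omega$ on $V$-valued forms (matrix action combined with wedge), with kernel $\ker(A\wedge\_)$ and image $\mathrm{Im}(A\wedge\_)$. Homotopy operator: with $\mathcal{K}=(x-x_{0})^{i}\partial_{i}$, for a $k$-form $\omega$, $k\ge 1$, $(H\omega)(x)=\int_{0}^{1}\mathcal{K}(x)\lrcorner\,\omega|_{x_{0}+t(x-x_{0})}\,t^{k-1}\,dt$, and $H=0$ on $0$-forms; it acts componentwise on vector-valued forms. It satisfies $H^{2}=0$ and $dH+Hd=I$ on forms of positive degree. $\mathcal{E}^{k}(U,V)=\ker d=\mathrm{im}(dH)$ (for $k>0$) is the space of exact (equivalently closed) $k$-forms; $\mathcal{A}^{k}(U,V)=\{\omega:\mathcal{K}\lrcorner\omega=0,\ \omega|_{x=x_{0}}=0\}=\ker H=\mathrm{im}(Hd)$ is the module of antiexact $k$-forms; $\Lambda^{k}(U,V)=\mathcal{E}^{k}(U,V)\oplus\mathcal{A}^{k}(U,V)$.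
   Formalization: "No solution" is claimed only if J_a∈Im(A∧_) or φ splits with A∧φ1 exact, A∧φ2 antiexact, φ3∈ker (false otherwise: A=dx, φ=z dy); likewise "the solution is given by". "Only constraint" reads: once A∧φ2=J_a, the φ1 equation is equivalent to d^∇φ=J. *)

theory Defs
  imports "HOL-Analysis.Analysis" "HOL-Library.Function_Algebras"
begin

text \<open>
  A \<open>k\<close>-form with values in \<open>'w\<close> assigns to a point \<open>x\<close> an alternating \<open>k\<close>-linear map. The \<open>k\<close>
  tangent vectors are the first \<open>k\<close> entries of a sequence; the remaining entries are ignored.
  Only the values at points of \<open>U\<close> matter, so two forms on \<open>U\<close> are identified when they agree on \<open>U\<close>.
  Sums and differences of forms are the pointwise ones.
\<close>

type_synonym ('a, 'w) form = "'a \<Rightarrow> (nat \<Rightarrow> 'a) \<Rightarrow> 'w"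

primrec Ck_on :: "nat \<Rightarrow> 'a::real_normed_vector set \<Rightarrow> ('a \<Rightarrow> 'w::real_normed_vector) \<Rightarrow> bool" where
  "Ck_on 0 U f \<longleftrightarrow> continuous_on U f"
| "Ck_on (Suc m) U f \<longleftrightarrow> (\<forall>x\<in>U. f differentiable (at x)) \<and>
     (\<forall>v. Ck_on m U (\<lambda>x. frechet_derivative f (at x) v))"

definition smooth_on :: "'a::real_normed_vector set \<Rightarrow> ('a \<Rightarrow> 'w::real_normed_vector) \<Rightarrow> bool" where
  "smooth_on U f \<longleftrightarrow> (\<forall>m. Ck_on m U f)"

definition alternating_multilinear ::
    "nat \<Rightarrow> ((nat \<Rightarrow> 'a::real_vector) \<Rightarrow> 'w::real_vector) \<Rightarrow> bool" where
  "alternating_multilinear k f \<longleftrightarrow>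
     (\<forall>v w. (\<forall>i<k. v i = w i) \<longrightarrow> f v = f w) \<and>
     (\<forall>v. \<forall>i<k. linear (\<lambda>u. f (v(i := u)))) \<and>
     (\<forall>v. \<forall>i<k. \<forall>j<k. i \<noteq> j \<longrightarrow> v i = v j \<longrightarrow> f v = 0)"

definition forms :: "'a::euclidean_space set \<Rightarrow> nat \<Rightarrow> ('a, 'w::real_normed_vector) form set" where
  "forms U k = {\<omega>. (\<forall>x\<in>U. alternating_multilinear k (\<omega> x)) \<and> (\<forall>v. smooth_on U (\<lambda>x. \<omega> x v))}"

definition forms_eq :: "'a set \<Rightarrow> ('a, 'w) form \<Rightarrow> ('a, 'w) form \<Rightarrow> bool" where
  "forms_eq U \<omega> \<eta> \<longleftrightarrow> (\<forall>x\<in>U. \<omega> x = \<eta> x)"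

definition omit :: "nat \<Rightarrow> (nat \<Rightarrow> 'a) \<Rightarrow> nat \<Rightarrow> 'a" where
  "omit i v = (\<lambda>j. if j < i then v j else v (Suc j))"

text \<open>
  Exterior derivative of a \<open>k\<close>-form. The arguments are constant vector fields, whose brackets vanish.
\<close>

definition ext_d :: "nat \<Rightarrow> ('a::euclidean_space, 'w::real_normed_vector) form \<Rightarrow> ('a, 'w) form" where
  "ext_d k \<omega> = (\<lambda>x v. \<Sum>i\<le>k. (-1) ^ i *\<^sub>R frechet_derivative (\<lambda>y. \<omega> y (omit i v)) (at x) (v i))"

text \<open>
  \<open>A \<and> \<omega>\<close> for an \<open>End(V)\<close>-valued one-form \<open>A\<close> and a \<open>V\<close>-valued \<open>k\<close>-form \<open>\<omega>\<close>, normalised without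
  factorials, that is, as the sum over \<open>(1,k)\<close>-shuffles.
\<close>

definition wedge1 :: "nat \<Rightarrow> ('a, 'v::real_normed_vector \<Rightarrow>\<^sub>L 'v) form \<Rightarrow> ('a, 'v) form \<Rightarrow> ('a, 'v) form" where
  "wedge1 k A \<omega> = (\<lambda>x v. \<Sum>i\<le>k. (-1) ^ i *\<^sub>R blinfun_apply (A x (\<lambda>_. v i)) (\<omega> x (omit i v)))"

definition contract :: "'a \<Rightarrow> ((nat \<Rightarrow> 'a) \<Rightarrow> 'w) \<Rightarrow> (nat \<Rightarrow> 'a) \<Rightarrow> 'w" where
  "contract u f = (\<lambda>v. f (case_nat u v))"

text \<open>
  The homotopy operator on \<open>k\<close>-forms. The radial field \<open>\<K>\<close> has the value \<open>x - x0\<close> at \<open>x\<close>.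
\<close>

definition homotopy_op ::
    "'a::euclidean_space \<Rightarrow> nat \<Rightarrow> ('a, 'w::real_normed_vector) form \<Rightarrow> ('a, 'w) form" where
  "homotopy_op x0 k \<omega> = (\<lambda>x v. if k = 0 then 0 else
     integral {0..1} (\<lambda>t. t ^ (k - 1) *\<^sub>R contract (x - x0) (\<omega> (x0 + t *\<^sub>R (x - x0))) v))"

definition exact_forms :: "'a::euclidean_space set \<Rightarrow> nat \<Rightarrow> ('a, 'w::real_normed_vector) form set" where
  "exact_forms U k = {\<omega> \<in> forms U k. forms_eq U (ext_d k \<omega>) 0}"

definition antiexact_forms ::
    "'a::euclidean_space set \<Rightarrow> 'a \<Rightarrow> nat \<Rightarrow> ('a, 'w::real_normed_vector) form set" where
  "antiexact_forms U x0 k =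
     {\<omega> \<in> forms U k. forms_eq U (\<lambda>x. contract (x - x0) (\<omega> x)) 0 \<and> \<omega> x0 = 0}"

text \<open>The parts \<open>d H J\<close> and \<open>H d J\<close> of a \<open>k\<close>-form \<open>J\<close>, for \<open>k > 0\<close>.\<close>

definition exact_part ::
    "'a::euclidean_space \<Rightarrow> nat \<Rightarrow> ('a, 'w::real_normed_vector) form \<Rightarrow> ('a, 'w) form" where
  "exact_part x0 k J = ext_d (k - 1) (homotopy_op x0 k J)"

definition antiexact_part ::
    "'a::euclidean_space \<Rightarrow> nat \<Rightarrow> ('a, 'w::real_normed_vector) form \<Rightarrow> ('a, 'w) form" where
  "antiexact_part x0 k J = homotopy_op x0 (k + 1) (ext_d k J)"

definition cov_d :: "nat \<Rightarrow> ('a::euclidean_space, 'v::real_normed_vector \<Rightarrow>\<^sub>L 'v) form \<Rightarrow>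
    ('a, 'v) form \<Rightarrow> ('a, 'v) form" where
  "cov_d k A \<phi> = ext_d k \<phi> + wedge1 k A \<phi>"

definition wedge_ker :: "'a::euclidean_space set \<Rightarrow> nat \<Rightarrow>
    ('a, 'v::real_normed_vector \<Rightarrow>\<^sub>L 'v) form \<Rightarrow> ('a, 'v) form set" where
  "wedge_ker U k A = {\<omega> \<in> forms U k. forms_eq U (wedge1 k A \<omega>) 0}"

definition wedge_im :: "'a::euclidean_space set \<Rightarrow> nat \<Rightarrow>
    ('a, 'v::real_normed_vector \<Rightarrow>\<^sub>L 'v) form \<Rightarrow> ('a, 'v) form set" where
  "wedge_im U k A = {\<eta> \<in> forms U (k + 1). \<exists>\<omega>\<in>forms U k. forms_eq U (wedge1 k A \<omega>) \<eta>}"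

definition constant_rank ::
    "'a::euclidean_space set \<Rightarrow> ('a, 'v::real_normed_vector \<Rightarrow>\<^sub>L 'v) form \<Rightarrow> bool" where
  "constant_rank U A \<longleftrightarrow> (\<exists>r. \<forall>x\<in>U. dim (range (\<lambda>u. A x (\<lambda>_. u))) = r)"

definition component_system :: "'a::euclidean_space set \<Rightarrow> 'a \<Rightarrow> nat \<Rightarrow>
    ('a, 'v::real_normed_vector \<Rightarrow>\<^sub>L 'v) form \<Rightarrow> ('a, 'v) form \<Rightarrow>
    ('a, 'v) form \<Rightarrow> ('a, 'v) form \<Rightarrow> ('a, 'v) form \<Rightarrow> bool" where
  "component_system U x0 k A J \<phi>1 \<phi>2 \<phi>3 \<longleftrightarrow>
     \<phi>1 \<in> forms U k \<and> \<phi>2 \<in> forms U k \<and> \<phi>3 \<in> wedge_ker U k A \<and>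
     forms_eq U (cov_d k A \<phi>1) (exact_part x0 (k + 1) J - ext_d k (\<phi>2 + \<phi>3)) \<and>
     forms_eq U (wedge1 k A \<phi>2) (antiexact_part x0 (k + 1) J)"

text \<open>
  A decomposition \<open>\<phi>1 + \<phi>2 + \<phi>3\<close> of the kind produced by the component system. It does not exist
  for every \<open>k\<close>-form \<open>\<phi>\<close>, not even for every solution of \<open>d\<phi> + A \<and> \<phi> = J\<close>: on a ball around
  \<open>x0 = 0\<close> in three-space, with one-dimensional \<open>V\<close> and \<open>A = dx\<close>, the form \<open>\<phi> = z dy\<close> solves the
  equation for \<open>J = d\<phi> + A \<and> \<phi>\<close>, but \<open>A \<and> H d J = (x/3) dx \<and> dy \<and> dz\<close> is not zero, whereas
  \<open>A \<and> A \<and> \<phi>2 = 0\<close> for all \<open>\<phi>2\<close>. So \<open>H d J\<close> is not in the image of \<open>A \<and> _\<close>.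
\<close>

definition admissible_splitting :: "'a::euclidean_space set \<Rightarrow> 'a \<Rightarrow> nat \<Rightarrow>
    ('a, 'v::real_normed_vector \<Rightarrow>\<^sub>L 'v) form \<Rightarrow>
    ('a, 'v) form \<Rightarrow> ('a, 'v) form \<Rightarrow> ('a, 'v) form \<Rightarrow> bool" where
  "admissible_splitting U x0 k A \<phi>1 \<phi>2 \<phi>3 \<longleftrightarrow>
     \<phi>1 \<in> forms U k \<and> \<phi>2 \<in> forms U k \<and> \<phi>3 \<in> wedge_ker U k A \<and>
     wedge1 k A \<phi>1 \<in> exact_forms U (k + 1) \<and> wedge1 k A \<phi>2 \<in> antiexact_forms U x0 (k + 1)"

end

theory Submission
  imports Defs
begin

text \<open>
  Write \<open>H\<close> for the homotopy operator. Everything rests on the homotopy formula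
  \<open>d H + H d = id\<close> in positive degree (\<open>homotopy_formula\<close>), which splits \<open>J\<close> into the closed form
  \<open>d H J\<close> and the antiexact form \<open>H d J\<close>. Given \<open>A \<and> \<phi>2 = H d J\<close> and \<open>A \<and> \<phi>3 = 0\<close>, the equation
  \<open>d\<phi> + A \<and> \<phi> = J\<close> for \<open>\<phi> = \<phi>1 + \<phi>2 + \<phi>3\<close> is the equation for \<open>\<phi>1\<close> in the component system with
  \<open>H d J\<close> added on both sides (\<open>component_system_iff\<close>). In a solution of the system, \<open>A \<and> \<phi>1\<close> is a
  difference of exact forms and \<open>A \<and> \<phi>2\<close> is a value of \<open>H\<close>, hence antiexact
  (\<open>component_system_solves\<close>).

  Conversely, suppose that \<open>\<phi>\<close> solves the equation, \<open>A \<and> \<phi>1\<close> is closed, \<open>A \<and> \<phi>2\<close> is antiexact and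
  \<open>A \<and> \<phi>3 = 0\<close>. Then \<open>J - A \<and> \<phi>2\<close> is closed, so \<open>H d J = H d (A \<and> \<phi>2) = A \<and> \<phi>2\<close>, because \<open>H\<close>
  annihilates antiexact forms (\<open>antiexact_part_unique\<close>). The statement on
  unsolvability follows: a solution \<open>\<phi>\<close> yields a solution of the system if it has a
  splitting of this kind, or if \<open>H d J = A \<and> \<phi>2\<close> for some \<open>\<phi>2\<close>, in which case \<open>\<phi>1 = \<phi> - \<phi>2\<close> and
  \<open>\<phi>3 = 0\<close> do.

  The analytic work is in the homotopy formula and in \<open>d d = 0\<close>. The latter combines the symmetry of
  second derivatives (\<open>frechet_derivative_symmetric\<close>) with a cancellation of signed sums
  (\<open>double_shuffle_sum_eq_0\<close>). For the former, \<open>H\<close> is expressed by weighted averages along rays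
  (\<open>radial_integral\<close>). These can be differentiated under the integral sign, which
  shows that \<open>H\<close> preserves smoothness, and they satisfy an integration by parts rule
  (\<open>radial_integral_by_parts\<close>), which produces the identity on the right-hand side of the formula.
\<close>

section \<open>Continuously differentiable functions\<close>

lemma Ck_on_has_derivative:
  assumes "Ck_on (Suc m) U f" and "x \<in> U"
  shows "(f has_derivative frechet_derivative f (at x)) (at x)"
  using assms frechet_derivative_works by auto

text \<open>
  Derivatives of all orders at a point of an open set depend only on the values on that set.
\<close>

lemma Ck_on_cong:
  assumes "open U" and "\<And>x. x \<in> U \<Longrightarrow> f x = g x" and "Ck_on m U f"
  shows "Ck_on m U g"
  using assms(2,3)
proof (induction m arbitrary: f g)
  case 0
  then show ?case by (auto cong: continuous_on_cong)
next
  case (Suc m)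
  have eq: "frechet_derivative g (at x) = frechet_derivative f (at x)" and df: "g differentiable (at x)"
    if "x \<in> U" for x
  proof -
    have "(g has_derivative frechet_derivative f (at x)) (at x)"
      using Ck_on_has_derivative[OF Suc.prems(2) that]
      by (rule has_derivative_transform_within_open[OF _ assms(1) that]) (simp add: Suc.prems(1))
    then show "frechet_derivative g (at x) = frechet_derivative f (at x)" "g differentiable (at x)"
      by (auto simp: frechet_derivative_at[symmetric] differentiable_def)
  qed
  have "Ck_on m U (\<lambda>x. frechet_derivative g (at x) v)" for v
  proof (rule Suc.IH)
    show "Ck_on m U (\<lambda>x. frechet_derivative f (at x) v)" using Suc.prems(2) by simp
  qed (simp add: eq)
  then show ?case using df by auto
qed

text \<open>
  The recursion in \<^const>\<open>Ck_on\<close> speaks of the chosen Frechet derivative; this form accepts any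
  derivative that a calculus rule delivers, so that the closure properties below follow by induction
  on the order.
\<close>

lemma Ck_on_SucI:
  assumes "open U" and "\<And>x. x \<in> U \<Longrightarrow> (f has_derivative f' x) (at x)"
    and "\<And>v. Ck_on m U (\<lambda>x. f' x v)"
  shows "Ck_on (Suc m) U f"
proof -
  have "Ck_on m U (\<lambda>x. frechet_derivative f (at x) v)" for v
    by (rule Ck_on_cong[OF assms(1) _ assms(3)[of v]]) (simp add: frechet_derivative_at[OF assms(2), symmetric])
  then show ?thesis using assms(2) by (auto simp: differentiable_def)
qed

lemma Ck_on_SucD: "Ck_on (Suc m) U f \<Longrightarrow> Ck_on m U f"
proof (induction m arbitrary: f)
  case 0
  then show ?case
    by (simp add: continuous_at_imp_continuous_on differentiable_imp_continuous_within)
next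
  case (Suc m)
  then show ?case unfolding Ck_on.simps(2) by blast
qed

lemma Ck_on_const: "open U \<Longrightarrow> Ck_on m U (\<lambda>x. c)"
  by (induction m arbitrary: c) auto

lemma Ck_on_bounded_linear:
  assumes "open U" and "bounded_linear f"
  shows "Ck_on m U f"
proof (cases m)
  case 0
  then show ?thesis using assms(2) by (simp add: linear_continuous_on)
next
  case (Suc n)
  have "Ck_on (Suc n) U f"
    using assms bounded_linear_imp_has_derivative[OF assms(2)]
    by (intro Ck_on_SucI[where f' = "\<lambda>_. f"] Ck_on_const) auto
  then show ?thesis using Suc by simp
qed

lemma Ck_on_add:
  assumes "open U" and "Ck_on m U f" and "Ck_on m U g"
  shows "Ck_on m U (\<lambda>x. f x + g x)"
  using assms(2,3)
proof (induction m arbitrary: f g)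
  case 0
  then show ?case by (auto intro: continuous_on_add)
next
  case (Suc m)
  show ?case
    using Suc.prems
    by (intro Ck_on_SucI[OF assms(1) has_derivative_add[OF Ck_on_has_derivative Ck_on_has_derivative]] Suc.IH)
      auto
qed

lemma Ck_on_sum:
  assumes "open U" and "\<And>i. i \<in> I \<Longrightarrow> Ck_on m U (f i)"
  shows "Ck_on m U (\<lambda>x. \<Sum>i\<in>I. f i x)"
  using assms(2)
  by (induction I rule: infinite_finite_induct) (auto intro: Ck_on_add Ck_on_const assms(1))

lemma Ck_on_bounded_bilinear:
  assumes "open U" and "bounded_bilinear B" and "Ck_on m U f" and "Ck_on m U g"
  shows "Ck_on m U (\<lambda>x. B (f x) (g x))"
  using assms(3,4)
proof (induction m arbitrary: f g)
  case 0
  then show ?case using bounded_bilinear.continuous_on[OF assms(2)] by simp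
next
  case (Suc m)
  show ?case
  proof (rule Ck_on_SucI[OF assms(1)])
    show "((\<lambda>x. B (f x) (g x)) has_derivative
        (\<lambda>v. B (f x) (frechet_derivative g (at x) v) + B (frechet_derivative f (at x) v) (g x))) (at x)"
      if "x \<in> U" for x
      using bounded_bilinear.FDERIV[OF assms(2) Ck_on_has_derivative[OF Suc.prems(1) that]
          Ck_on_has_derivative[OF Suc.prems(2) that]] .
    show "Ck_on m U (\<lambda>x. B (f x) (frechet_derivative g (at x) v) + B (frechet_derivative f (at x) v) (g x))" for v
      using Suc.prems Suc.prems[THEN Ck_on_SucD] by (intro Ck_on_add assms(1) Suc.IH) auto
  qed
qed

lemma Ck_on_scaleR_const:
  assumes "open U" and "Ck_on m U f"
  shows "Ck_on m U (\<lambda>x. c *\<^sub>R f x)"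
  by (rule Ck_on_bounded_bilinear[OF assms(1) bounded_bilinear_scaleR Ck_on_const[OF assms(1)] assms(2)])

lemma smooth_on_frechet_derivative: "smooth_on U f \<Longrightarrow> smooth_on U (\<lambda>x. frechet_derivative f (at x) v)"
  unfolding smooth_on_def by (metis Ck_on.simps(2))

lemma smooth_on_has_derivative:
  "smooth_on U f \<Longrightarrow> x \<in> U \<Longrightarrow> (f has_derivative frechet_derivative f (at x)) (at x)"
  unfolding smooth_on_def using Ck_on_has_derivative by blast

lemma smooth_on_imp_continuous_on: "smooth_on U f \<Longrightarrow> continuous_on U f"
  unfolding smooth_on_def by (metis Ck_on.simps(1))

section \<open>Symmetry of second derivatives\<close>

text \<open>
  The mean value theorem, first along \<open>u\<close> and then along \<open>v\<close>, turns the second difference over a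
  parallelogram with sides \<open>t *\<^sub>R u\<close> and \<open>t *\<^sub>R v\<close> into \<open>t\<^sup>2\<close> times a second derivative at a point of
  that parallelogram, which converges by continuity.
\<close>

lemma second_difference_quotient_tendsto:
  fixes f :: "'a::real_normed_vector \<Rightarrow> real"
  assumes "e > 0"
    and Df: "\<And>y. y \<in> ball x e \<Longrightarrow> (f has_derivative Df y) (at y)"
    and D2f: "\<And>y. y \<in> ball x e \<Longrightarrow> ((\<lambda>z. Df z u) has_derivative D2f y) (at y)"
    and cont: "isCont (\<lambda>y. D2f y v) x"
  shows "((\<lambda>t. (f (x + t *\<^sub>R u + t *\<^sub>R v) - f (x + t *\<^sub>R u) - f (x + t *\<^sub>R v) + f x) / t\<^sup>2)
    \<longlongrightarrow> D2f x v) (at_right 0)"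
proof (rule tendstoI)
  fix \<epsilon> :: real assume "\<epsilon> > 0"
  with cont obtain d where d: "d > 0" "\<And>y. dist y x < d \<Longrightarrow> dist (D2f y v) (D2f x v) < \<epsilon>"
    unfolding continuous_at_eps_delta by blast
  \<comment> \<open>Parallelograms with \<open>t < r\<close> stay within distance \<open>min d e\<close> of \<open>x\<close>. The summand \<open>1\<close> allows
    \<open>u = v = 0\<close>.\<close>
  define r where "r = min d e / (norm u + norm v + 1)"
  have N: "norm u + norm v + 1 > 0" by (simp add: add_nonneg_pos)
  have "r > 0" using d(1) assms(1) N by (simp add: r_def)
  have "dist ((f (x + t *\<^sub>R u + t *\<^sub>R v) - f (x + t *\<^sub>R u) - f (x + t *\<^sub>R v) + f x) / t\<^sup>2) (D2f x v) < \<epsilon>"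
    if t: "0 < t" "t < r" for t
  proof -
    have near: "dist (x + a *\<^sub>R u + b *\<^sub>R v) x < min d e" if ab: "0 \<le> a" "a \<le> t" "0 \<le> b" "b \<le> t" for a b
    proof -
      have "dist (x + a *\<^sub>R u + b *\<^sub>R v) x = norm (a *\<^sub>R u + b *\<^sub>R v)" by (simp add: dist_norm algebra_simps)
      also have "\<dots> \<le> a * norm u + b * norm v" using ab by (metis abs_of_nonneg norm_scaleR norm_triangle_ineq)
      also have "\<dots> \<le> t * norm u + t * norm v" using ab by (intro add_mono mult_right_mono) auto
      also have "\<dots> \<le> t * (norm u + norm v + 1)" using t by (simp add: algebra_simps)
      also have "\<dots> < min d e" using t N by (simp add: r_def pos_less_divide_eq)
      finally show ?thesis .
    qed
    have inb: "x + a *\<^sub>R u + b *\<^sub>R v \<in> ball x e" if "0 \<le> a" "a \<le> t" "0 \<le> b" "b \<le> t" for a b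
      using near[OF that] by (simp add: dist_commute)
    have d1: "((\<lambda>s. f (x + s *\<^sub>R u + b *\<^sub>R v)) has_real_derivative Df (x + s *\<^sub>R u + b *\<^sub>R v) u) (at s)"
      if "0 \<le> s" "s \<le> t" "0 \<le> b" "b \<le> t" for s b
    proof -
      have "((\<lambda>s. x + s *\<^sub>R u + b *\<^sub>R v) has_derivative (\<lambda>h. h *\<^sub>R u)) (at s)"
        by (auto intro!: derivative_eq_intros)
      from has_derivative_compose[OF this Df[OF inb[OF that]]]
      have "((\<lambda>s. f (x + s *\<^sub>R u + b *\<^sub>R v)) has_derivative (\<lambda>h. Df (x + s *\<^sub>R u + b *\<^sub>R v) (h *\<^sub>R u))) (at s)" .
      moreover have "(\<lambda>h. Df (x + s *\<^sub>R u + b *\<^sub>R v) (h *\<^sub>R u)) = (*) (Df (x + s *\<^sub>R u + b *\<^sub>R v) u)"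
        using linear_scale[OF has_derivative_linear[OF Df[OF inb[OF that]]]] by (auto simp: mult.commute)
      ultimately show ?thesis by (simp add: has_field_derivative_def)
    qed
    have d2: "((\<lambda>s. Df (x + a *\<^sub>R u + s *\<^sub>R v) u) has_real_derivative D2f (x + a *\<^sub>R u + s *\<^sub>R v) v) (at s)"
      if "0 \<le> a" "a \<le> t" "0 \<le> s" "s \<le> t" for s a
    proof -
      have "((\<lambda>s. x + a *\<^sub>R u + s *\<^sub>R v) has_derivative (\<lambda>h. h *\<^sub>R v)) (at s)"
        by (auto intro!: derivative_eq_intros)
      from has_derivative_compose[OF this D2f[OF inb[OF that]]]
      have "((\<lambda>s. Df (x + a *\<^sub>R u + s *\<^sub>R v) u) has_derivative (\<lambda>h. D2f (x + a *\<^sub>R u + s *\<^sub>R v) (h *\<^sub>R v))) (at s)" .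
      moreover have "(\<lambda>h. D2f (x + a *\<^sub>R u + s *\<^sub>R v) (h *\<^sub>R v)) = (*) (D2f (x + a *\<^sub>R u + s *\<^sub>R v) v)"
        using linear_scale[OF has_derivative_linear[OF D2f[OF inb[OF that]]]] by (auto simp: mult.commute)
      ultimately show ?thesis by (simp add: has_field_derivative_def)
    qed
    have "\<exists>a>0. a < t \<and> (f (x + t *\<^sub>R u + t *\<^sub>R v) - f (x + t *\<^sub>R u + 0 *\<^sub>R v))
        - (f (x + 0 *\<^sub>R u + t *\<^sub>R v) - f (x + 0 *\<^sub>R u + 0 *\<^sub>R v))
        = (t - 0) * (Df (x + a *\<^sub>R u + t *\<^sub>R v) u - Df (x + a *\<^sub>R u + 0 *\<^sub>R v) u)"
      using t(1) by (intro MVT2 derivative_intros d1) auto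
    then obtain a where a: "0 < a" "a < t" and 1: "f (x + t *\<^sub>R u + t *\<^sub>R v) - f (x + t *\<^sub>R u)
        - f (x + t *\<^sub>R v) + f x = t * (Df (x + a *\<^sub>R u + t *\<^sub>R v) u - Df (x + a *\<^sub>R u + 0 *\<^sub>R v) u)"
      by (auto simp: algebra_simps)
    have "\<exists>b>0. b < t \<and> Df (x + a *\<^sub>R u + t *\<^sub>R v) u - Df (x + a *\<^sub>R u + 0 *\<^sub>R v) u
        = (t - 0) * D2f (x + a *\<^sub>R u + b *\<^sub>R v) v"
      using t(1) a by (intro MVT2 d2) auto
    then obtain b where b: "0 < b" "b < t"
      and 2: "Df (x + a *\<^sub>R u + t *\<^sub>R v) u - Df (x + a *\<^sub>R u + 0 *\<^sub>R v) u = t * D2f (x + a *\<^sub>R u + b *\<^sub>R v) v"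
      by auto
    have "(f (x + t *\<^sub>R u + t *\<^sub>R v) - f (x + t *\<^sub>R u) - f (x + t *\<^sub>R v) + f x) / t\<^sup>2
        = D2f (x + a *\<^sub>R u + b *\<^sub>R v) v"
      unfolding 1 2 using t(1) by (simp add: power2_eq_square)
    then show ?thesis using d(2)[of "x + a *\<^sub>R u + b *\<^sub>R v"] near[of a b] a b by simp
  qed
  then show "\<forall>\<^sub>F t in at_right 0. dist ((f (x + t *\<^sub>R u + t *\<^sub>R v) - f (x + t *\<^sub>R u) - f (x + t *\<^sub>R v) + f x) / t\<^sup>2)
      (D2f x v) < \<epsilon>"
    unfolding eventually_at_right_field using \<open>r > 0\<close> by blast
qed

text \<open>
  The second difference does not change when the two directions are exchanged, hence neither does
  its limit. Vector values are treated coordinate by coordinate, because the mean value theorem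
  with equality holds for real values only.
\<close>

lemma frechet_derivative_symmetric:
  fixes f :: "'a::real_normed_vector \<Rightarrow> 'w::euclidean_space"
  assumes "open U" and "x \<in> U" and C2: "Ck_on 2 U f"
  shows "frechet_derivative (\<lambda>y. frechet_derivative f (at y) u) (at x) v
       = frechet_derivative (\<lambda>y. frechet_derivative f (at y) v) (at x) u"
proof (rule euclidean_eqI)
  fix b :: 'w assume "b \<in> Basis"
  let ?D = "\<lambda>w y. frechet_derivative f (at y) w"
  let ?D2 = "\<lambda>w y. frechet_derivative (?D w) (at y)"
  have C2': "Ck_on (Suc (Suc 0)) U f" using C2 by (simp add: numeral_2_eq_2)
  obtain e where e: "e > 0" "ball x e \<subseteq> U" using assms(1,2) openE by blast
  have lim: "((\<lambda>t. (f (x + t *\<^sub>R u + t *\<^sub>R v) \<bullet> b - f (x + t *\<^sub>R u) \<bullet> b - f (x + t *\<^sub>R v) \<bullet> b + f x \<bullet> b) / t\<^sup>2)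
    \<longlongrightarrow> ?D2 u x v \<bullet> b) (at_right 0)" for u v
  proof (rule second_difference_quotient_tendsto[OF e(1), where Df = "\<lambda>y w. ?D w y \<bullet> b" and D2f = "\<lambda>y w. ?D2 u y w \<bullet> b"])
    fix y assume "y \<in> ball x e"
    then have y: "y \<in> U" using e by auto
    show "((\<lambda>z. f z \<bullet> b) has_derivative (\<lambda>w. ?D w y \<bullet> b)) (at y)"
      by (rule has_derivative_inner_left[OF Ck_on_has_derivative[OF C2' y]])
    have "Ck_on (Suc 0) U (?D u)" using C2' by (metis Ck_on.simps(2))
    then show "((\<lambda>z. ?D u z \<bullet> b) has_derivative (\<lambda>w. ?D2 u y w \<bullet> b)) (at y)"
      by (rule has_derivative_inner_left[OF Ck_on_has_derivative[OF _ y]])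
  next
    have "continuous_on U (\<lambda>y. ?D2 u y v)" using C2' by simp
    then show "isCont (\<lambda>y. ?D2 u y v \<bullet> b) x"
      using assms(1,2) by (auto simp: continuous_on_eq_continuous_at intro: isCont_inner)
  qed
  have "?D2 u x v \<bullet> b = ?D2 v x u \<bullet> b"
  proof (rule tendsto_unique[OF _ lim[of u v]])
    show "((\<lambda>t. (f (x + t *\<^sub>R u + t *\<^sub>R v) \<bullet> b - f (x + t *\<^sub>R u) \<bullet> b - f (x + t *\<^sub>R v) \<bullet> b + f x \<bullet> b) / t\<^sup>2)
      \<longlongrightarrow> ?D2 v x u \<bullet> b) (at_right 0)"
      using lim[of v u] by (simp add: algebra_simps)
  qed simp
  then show "frechet_derivative (\<lambda>y. frechet_derivative f (at y) u) (at x) v \<bullet> b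
       = frechet_derivative (\<lambda>y. frechet_derivative f (at y) v) (at x) u \<bullet> b" .
qed

section \<open>Signed sums over omitted arguments\<close>

text \<open>
  The inverse of \<^const>\<open>omit\<close>. Moving the inserted entry one place at a time exhibits the sign of
  a cyclic permutation as that of a product of transpositions.
\<close>

definition insert_at :: "nat \<Rightarrow> 'a \<Rightarrow> (nat \<Rightarrow> 'a) \<Rightarrow> nat \<Rightarrow> 'a" where
  "insert_at p c w = (\<lambda>j. if j < p then w j else if j = p then c else w (j - 1))"

lemma insert_at_omit: "insert_at i (v i) (omit i v) = v"
  by (auto simp: insert_at_def omit_def fun_eq_iff)

lemma insert_at_0: "insert_at 0 c w = case_nat c w"
  by (auto simp: insert_at_def fun_eq_iff split: nat.split)

lemma omit_omit: "i \<le> j \<Longrightarrow> omit j (omit i v) = omit i (omit (Suc j) v)"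
  by (auto simp: omit_def fun_eq_iff)

lemma omit_0_case_nat: "omit 0 (case_nat c v) = v"
  by (auto simp: omit_def)

lemma omit_Suc_case_nat: "omit (Suc i) (case_nat c v) = case_nat c (omit i v)"
  by (auto simp: omit_def fun_eq_iff split: nat.split)

lemma case_nat_update: "case_nat c (v(i := u)) = (case_nat c v)(Suc i := u)"
  by (auto simp: fun_eq_iff split: nat.split)

lemma omit_update_less: "j < i \<Longrightarrow> omit i (v(j := u)) = (omit i v)(j := u)"
  by (auto simp: omit_def fun_eq_iff)

lemma omit_update_same: "omit i (v(i := u)) = omit i v"
  by (auto simp: omit_def fun_eq_iff)

lemma omit_update_greater: "i < j \<Longrightarrow> omit i (v(j := u)) = (omit i v)(j - 1 := u)"
  by (auto simp: omit_def fun_eq_iff)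

lemma alternating_cong:
  assumes "alternating_multilinear k f" and "\<And>i. i < k \<Longrightarrow> v i = w i"
  shows "f v = f w"
  using assms(1)[unfolded alternating_multilinear_def, THEN conjunct1, rule_format, of v w] assms(2) by simp

lemma alternating_linear: "alternating_multilinear k f \<Longrightarrow> i < k \<Longrightarrow> linear (\<lambda>u. f (v(i := u)))"
  unfolding alternating_multilinear_def by blast

lemma alternating_eq_0:
  "alternating_multilinear k f \<Longrightarrow> i < k \<Longrightarrow> j < k \<Longrightarrow> i \<noteq> j \<Longrightarrow> v i = v j \<Longrightarrow> f v = 0"
  unfolding alternating_multilinear_def by blast

text \<open>
  Polarisation: expand the value with \<open>a + b\<close> in both slots, which is zero.
\<close>

lemma alternating_swap:
  assumes f: "alternating_multilinear k f" and "i < k" "j < k" "i \<noteq> j"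
  shows "f (v(i := a, j := b)) = - f (v(i := b, j := a))"
proof -
  have addj: "f (v(i := c, j := a + b)) = f (v(i := c, j := a)) + f (v(i := c, j := b))" for c
    using linear_add[OF alternating_linear[OF f \<open>j < k\<close>]] .
  have addi: "f (v(i := a + b, j := c)) = f (v(i := a, j := c)) + f (v(i := b, j := c))" for c
    using linear_add[OF alternating_linear[OF f \<open>i < k\<close>, of "v(j := c)"], of a b] \<open>i \<noteq> j\<close>
    by (simp add: fun_upd_twist)
  have z: "f (v(i := c, j := c)) = 0" for c
    using assms by (intro alternating_eq_0[OF f, of i j]) auto
  have "0 = f (v(i := a + b, j := a + b))"
    by (rule z[symmetric])
  also have "\<dots> = f (v(i := a, j := b)) + f (v(i := b, j := a))"
    unfolding addj addi by (simp add: z)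
  finally show ?thesis by (metis eq_neg_iff_add_eq_0)
qed

text \<open>
  Bringing the entry at position \<open>p\<close> to the front takes \<open>p\<close> adjacent transpositions.
\<close>

lemma alternating_insert_at:
  assumes f: "alternating_multilinear k f" and "p < k"
  shows "f (insert_at p c w) = (-1) ^ p *\<^sub>R f (case_nat c w)"
  using assms(2)
proof (induction p)
  case 0
  then show ?case by (simp add: insert_at_0)
next
  case (Suc p)
  let ?v = "insert_at p c w"
  have 1: "insert_at (Suc p) c w = ?v(p := w p, Suc p := c)"
    by (auto simp: insert_at_def fun_eq_iff)
  have 2: "?v(p := c, Suc p := w p) = ?v"
    by (auto simp: insert_at_def fun_eq_iff)
  have "f (insert_at (Suc p) c w) = - f ?v"
    unfolding 1 using alternating_swap[OF f, of p "Suc p" ?v "w p" c] Suc.prems by (simp add: 2)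
  then show ?case using Suc by simp
qed

lemma alternating_case_nat:
  assumes f: "alternating_multilinear (Suc k) f"
  shows "alternating_multilinear k (\<lambda>v. f (case_nat c v))"
  unfolding alternating_multilinear_def
proof (intro conjI allI impI)
  fix v w :: "nat \<Rightarrow> 'a" assume "\<forall>i<k. v i = w i"
  then show "f (case_nat c v) = f (case_nat c w)"
    by (intro alternating_cong[OF f]) (auto split: nat.split)
next
  fix v :: "nat \<Rightarrow> 'a" and i assume "i < k"
  then show "linear (\<lambda>u. f (case_nat c (v(i := u))))"
    unfolding case_nat_update by (intro alternating_linear[OF f]) simp
next
  fix v :: "nat \<Rightarrow> 'a" and i j assume "i < k" "j < k" "i \<noteq> j" "v i = v j"
  then show "f (case_nat c v) = 0"
    by (intro alternating_eq_0[OF f, of "Suc i" "Suc j"]) auto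
qed

text \<open>
  The common algebra behind the exterior derivative, where \<open>B u\<close> differentiates in direction \<open>u\<close>,
  and the product with a one-form, where \<open>B u\<close> applies the endomorphism belonging to \<open>u\<close>. If two
  arguments coincide, only the two summands that omit one of them survive, and these differ by the
  sign of a cyclic permutation that makes them cancel.
\<close>

lemma alternating_shuffle_sum:
  assumes alt: "\<And>u. alternating_multilinear k (B u)" and lin: "\<And>w. linear (\<lambda>u. B u w)"
  shows "alternating_multilinear (Suc k) (\<lambda>v. \<Sum>i\<le>k. (-1) ^ i *\<^sub>R B (v i) (omit i v))"
  unfolding alternating_multilinear_def
proof (intro conjI allI impI)
  fix v w :: "nat \<Rightarrow> 'a" assume vw: "\<forall>i<Suc k. v i = w i"
  have "B (v i) (omit i v) = B (w i) (omit i w)" if "i \<le> k" for i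
  proof -
    have "B (v i) (omit i v) = B (v i) (omit i w)"
      using vw by (intro alternating_cong[OF alt, of "omit i v" "omit i w"]) (simp add: omit_def)
    then show ?thesis using vw that by simp
  qed
  then show "(\<Sum>i\<le>k. (-1) ^ i *\<^sub>R B (v i) (omit i v)) = (\<Sum>i\<le>k. (-1) ^ i *\<^sub>R B (w i) (omit i w))"
    by simp
next
  fix v :: "nat \<Rightarrow> 'a" and j assume j: "j < Suc k"
  have "linear (\<lambda>u. B ((v(j := u)) i) (omit i (v(j := u))))" if "i \<le> k" for i
  proof (rule linorder_cases[of j i])
    assume "j < i"
    then show ?thesis using that by (simp add: omit_update_less alternating_linear[OF alt])
  next
    assume "j = i"
    then show ?thesis by (simp add: omit_update_same lin)
  next
    assume "i < j"
    then show ?thesis using that j by (simp add: omit_update_greater alternating_linear[OF alt])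
  qed
  then show "linear (\<lambda>u. \<Sum>i\<le>k. (-1) ^ i *\<^sub>R B ((v(j := u)) i) (omit i (v(j := u))))"
    by (intro linear_compose_sum ballI linear_compose_scale_right) auto
next
  fix v :: "nat \<Rightarrow> 'a" and a b
  have *: "(\<Sum>i\<le>k. (-1) ^ i *\<^sub>R B (v i) (omit i v)) = 0" if ab: "a < b" "b < Suc k" "v a = v b" for a b
  proof -
    have zero: "(-1) ^ i *\<^sub>R B (v i) (omit i v) = 0" if i: "i \<le> k" "i \<noteq> a" "i \<noteq> b" for i
    proof -
      \<comment> \<open>The place of the \<open>j\<close>-th entry after the \<open>i\<close>-th one has been removed.\<close>
      have at: "omit i v (if j < i then j else j - 1) = v j" if "j \<noteq> i" for j
        using that by (auto simp: omit_def)
      have "(if a < i then a else a - 1) < k" "(if b < i then b else b - 1) < k"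
          "(if a < i then a else a - 1) \<noteq> (if b < i then b else b - 1)"
        using ab i by auto
      then have "B (v i) (omit i v) = 0"
        by (rule alternating_eq_0[OF alt]) (use ab(3) i at[of a] at[of b] in simp)
      then show ?thesis by simp
    qed
    \<comment> \<open>With \<open>b\<close> omitted the common vector stands at \<open>a\<close>, with \<open>a\<close> omitted it stands at \<open>b - 1\<close>. Both
      values are compared with the one where it stands in front of \<open>?w\<close>.\<close>
    let ?w = "omit a (omit b v)"
    have wa: "omit b v = insert_at a (v a) ?w"
    proof -
      have "omit b v a = v a" using ab by (simp add: omit_def)
      then show ?thesis using insert_at_omit[of a "omit b v"] by simp
    qed
    have "omit (b - 1) (omit a v) = ?w" using omit_omit[of a "b - 1" v] ab by simp
    have wb: "omit a v = insert_at (b - 1) (v a) ?w"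
    proof -
      have "omit a v (b - 1) = v a" using ab by (auto simp: omit_def)
      then show ?thesis using insert_at_omit[of "b - 1" "omit a v"] \<open>omit (b - 1) (omit a v) = ?w\<close> by simp
    qed
    let ?X = "B (v a) (case_nat (v a) ?w)"
    have A: "B (v a) (omit a v) = (-1) ^ (b - 1) *\<^sub>R ?X"
      using ab by (subst wb, intro alternating_insert_at[OF alt]) auto
    have B: "B (v b) (omit b v) = (-1) ^ a *\<^sub>R ?X"
      using ab by (subst wa, subst ab(3)[symmetric], intro alternating_insert_at[OF alt]) auto
    have "(\<Sum>i\<le>k. (-1) ^ i *\<^sub>R B (v i) (omit i v)) = (\<Sum>i\<in>{a,b}. (-1) ^ i *\<^sub>R B (v i) (omit i v))"
      using ab by (intro sum.mono_neutral_right) (auto simp: zero)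
    also have "\<dots> = ((-1) ^ a * (-1) ^ (b - 1) + (-1) ^ b * (-1) ^ a) *\<^sub>R ?X"
      using ab(1) by (simp add: A B scaleR_left_distrib)
    also have "\<dots> = 0"
      using ab(1) by (cases b) auto
    finally show ?thesis .
  qed
  assume "a < Suc k" "b < Suc k" "a \<noteq> b" "v a = v b"
  then show "(\<Sum>i\<le>k. (-1) ^ i *\<^sub>R B (v i) (omit i v)) = 0"
    using *[of a b] *[of b a] by (cases "a < b") simp_all
qed

text \<open>
  Two entries can be omitted in either order, and \<open>S\<close> does not see which order was taken. The orders
  correspond under \<open>(i, j) \<mapsto> (Suc j, i)\<close> for \<open>i \<le> j\<close>, and the shift of one index reverses the sign,
  so that the two halves of the sum cancel.
\<close>

lemma double_shuffle_sum_eq_0: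
  fixes S :: "'a \<Rightarrow> 'a \<Rightarrow> (nat \<Rightarrow> 'a) \<Rightarrow> 'w::real_vector"
  assumes sym: "\<And>a b w. S a b w = S b a w"
  shows "(\<Sum>i\<le>Suc k. (-1) ^ i *\<^sub>R (\<Sum>j\<le>k. (-1) ^ j *\<^sub>R S (v i) (omit i v j) (omit j (omit i v)))) = 0"
proof -
  define T where "T = (\<lambda>(i,j). (-1) ^ (i + j) *\<^sub>R S (v i) (omit i v j) (omit j (omit i v)))"
  let ?P = "{(i,j). i \<le> j \<and> j \<le> k}" and ?N = "{(i,j). j < i \<and> i \<le> Suc k}"
  have fin: "finite ?P" "finite ?N"
    by (rule finite_subset[of _ "{..Suc k} \<times> {..Suc k}"]; auto)+
  have "(\<Sum>i\<le>Suc k. (-1) ^ i *\<^sub>R (\<Sum>j\<le>k. (-1) ^ j *\<^sub>R S (v i) (omit i v j) (omit j (omit i v))))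
      = (\<Sum>p\<in>{..Suc k} \<times> {..k}. T p)"
    by (simp add: sum.cartesian_product[symmetric] T_def scaleR_sum_right power_add del: sum.atMost_Suc)
  also have "{..Suc k} \<times> {..k} = ?P \<union> ?N" by auto
  also have "sum T (?P \<union> ?N) = sum T ?P + sum T ?N"
    using fin by (intro sum.union_disjoint) auto
  also have "sum T ?N = (\<Sum>p\<in>?P. - T p)"
  proof (rule sum.reindex_bij_witness[where i = "\<lambda>(i,j). (Suc j, i)" and j = "\<lambda>(i,j). (j, i - 1)"])
    fix p assume "p \<in> ?N"
    then obtain i j where p: "p = (Suc i, j)" "j \<le> i" "i \<le> k"
      by (cases p; cases "fst p") auto
    have "omit (Suc i) v j = v j" "omit j v i = v (Suc i)" using p by (auto simp: omit_def)
    then show "- T (case p of (i, j) \<Rightarrow> (j, i - 1)) = T p"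
      using omit_omit[of j i v] p sym[of "v j"] by (simp add: T_def add.commute)
  qed auto
  finally show ?thesis by (simp add: sum_negf)
qed

section \<open>Averages along rays of a star-shaped domain\<close>

locale star_domain =
  fixes U :: "'a::euclidean_space set" and x0 :: 'a
  assumes open_domain: "open U"
    and centre: "x0 \<in> U"
    and star_shaped: "x \<in> U \<Longrightarrow> closed_segment x0 x \<subseteq> U"

text \<open>
  The weighted average of \<open>g\<close> along the ray from the centre to \<open>x\<close>. The homotopy operator has this
  shape, except that its integrand also depends on \<open>x\<close> through the factor \<open>x - x0\<close> in the first
  slot. Without that factor, a derivative passes to \<open>g\<close> and only raises the exponent \<open>m\<close> by one.
\<close>

definition radial_integral :: "'a::euclidean_space \<Rightarrow> nat \<Rightarrow> ('a \<Rightarrow> 'w::real_normed_vector) \<Rightarrow> 'a \<Rightarrow> 'w" where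
  "radial_integral x0 m g x = integral {0..1} (\<lambda>t. t ^ m *\<^sub>R g (x0 + t *\<^sub>R (x - x0)))"

context star_domain
begin

lemma ray_in_domain:
  assumes "x \<in> U" and "t \<in> {0..1}"
  shows "x0 + t *\<^sub>R (x - x0) \<in> U"
proof -
  have "x0 + t *\<^sub>R (x - x0) \<in> closed_segment x0 x"
    using assms(2) by (auto simp: in_segment algebra_simps intro!: exI[of _ t])
  then show ?thesis using star_shaped[OF assms(1)] by blast
qed

lemma continuous_on_radial_integrand:
  fixes g :: "'a \<Rightarrow> 'w::real_normed_vector"
  assumes "continuous_on U g" and "V \<subseteq> U"
  shows "continuous_on (V \<times> {0..1}) (\<lambda>(x, t). t ^ m *\<^sub>R g (x0 + t *\<^sub>R (x - x0)))"
  unfolding split_beta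
  by (intro continuous_intros continuous_on_compose2[OF assms(1)])
    (use assms(2) ray_in_domain in auto)

lemma radial_integrand_integrable:
  fixes g :: "'a \<Rightarrow> 'w::banach"
  assumes "continuous_on U g" and "x \<in> U"
  shows "(\<lambda>t. t ^ m *\<^sub>R g (x0 + t *\<^sub>R (x - x0))) integrable_on {0..1}"
  by (intro integrable_continuous_real continuous_intros continuous_on_compose2[OF assms(1)])
    (use assms(2) ray_in_domain in auto)

lemma radial_integral_cong:
  assumes "x \<in> U" and "\<And>y. y \<in> U \<Longrightarrow> g y = h y"
  shows "radial_integral x0 m g x = radial_integral x0 m h x"
  unfolding radial_integral_def using assms ray_in_domain by (intro integral_cong) auto

lemma radial_integral_scaleR: "radial_integral x0 m (\<lambda>y. c *\<^sub>R g y) x = c *\<^sub>R radial_integral x0 m g x"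
  unfolding radial_integral_def by (subst integral_cmul[symmetric]) (simp add: mult.commute)

lemma radial_integral_sum:
  fixes g :: "'i \<Rightarrow> 'a \<Rightarrow> 'w::banach"
  assumes "finite I" and "\<And>i. i \<in> I \<Longrightarrow> continuous_on U (g i)" and "x \<in> U"
  shows "radial_integral x0 m (\<lambda>y. \<Sum>i\<in>I. g i y) x = (\<Sum>i\<in>I. radial_integral x0 m (g i) x)"
  unfolding radial_integral_def scaleR_sum_right
  using assms by (intro integral_sum radial_integrand_integrable) auto

lemma radial_integral_add:
  fixes g h :: "'a \<Rightarrow> 'w::banach"
  assumes "continuous_on U g" and "continuous_on U h" and "x \<in> U"
  shows "radial_integral x0 m (\<lambda>y. g y + h y) x = radial_integral x0 m g x + radial_integral x0 m h x"
  unfolding radial_integral_def scaleR_add_right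
  using assms by (intro integral_add radial_integrand_integrable)

text \<open>
  Differentiation under the integral sign. A ball around \<open>x\<close> supplies the convex set on which the
  Leibniz rule works; its rays to the centre stay in \<open>U\<close>. Continuity of the derivative as
  a map into the bounded linear operators follows from that of the directional derivatives, since
  the space is finite-dimensional.
\<close>

lemma radial_integral_has_derivative:
  fixes g :: "'a \<Rightarrow> 'w::banach"
  assumes C1: "Ck_on (Suc 0) U g" and "x \<in> U"
  shows "(radial_integral x0 m g has_derivative
    (\<lambda>v. radial_integral x0 (Suc m) (\<lambda>y. frechet_derivative g (at y) v) x)) (at x)"
proof -
  obtain e where e: "e > 0" "ball x e \<subseteq> U" using open_domain assms(2) openE by blast
  define D where "D y = Blinfun (frechet_derivative g (at y))" for y
  have D: "blinfun_apply (D y) = frechet_derivative g (at y)" if "y \<in> U" for y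
    unfolding D_def using has_derivative_bounded_linear[OF Ck_on_has_derivative[OF C1 that]]
    by (rule bounded_linear_Blinfun_apply)
  have contD: "continuous_on U D"
  proof (rule continuous_on_blinfun_componentwise)
    fix i :: 'a
    have "continuous_on U (\<lambda>y. frechet_derivative g (at y) i)" using C1 by simp
    then show "continuous_on U (\<lambda>y. blinfun_apply (D y) i)" by (simp add: D cong: continuous_on_cong)
  qed
  let ?D = "\<lambda>y t. t ^ Suc m *\<^sub>R D (x0 + t *\<^sub>R (y - x0))"
  have contg: "continuous_on U g" using Ck_on_SucD[OF C1] by simp
  have "((\<lambda>y. integral (cbox 0 1) (\<lambda>t. t ^ m *\<^sub>R g (x0 + t *\<^sub>R (y - x0)))) has_derivative
      blinfun_apply (integral (cbox 0 1) (?D x))) (at x within ball x e)"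
  proof (rule leibniz_rule)
    fix y and t :: real assume "y \<in> ball x e" and t: "t \<in> cbox 0 1"
    then have y: "y \<in> U" using e by auto
    let ?z = "x0 + t *\<^sub>R (y - x0)"
    have z: "?z \<in> U" using ray_in_domain[OF y] t by simp
    have "((\<lambda>y. x0 + t *\<^sub>R (y - x0)) has_derivative (\<lambda>v. t *\<^sub>R v)) (at y within ball x e)"
      by (auto intro!: derivative_eq_intros)
    from has_derivative_compose[OF this Ck_on_has_derivative[OF C1 z]]
    have "((\<lambda>y. t ^ m *\<^sub>R g (x0 + t *\<^sub>R (y - x0))) has_derivative
        (\<lambda>v. t ^ m *\<^sub>R frechet_derivative g (at ?z) (t *\<^sub>R v))) (at y within ball x e)"
      by (rule has_derivative_scaleR_right)
    moreover have "frechet_derivative g (at ?z) (t *\<^sub>R v) = t *\<^sub>R frechet_derivative g (at ?z) v" for v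
      using linear_scale[OF has_derivative_linear[OF Ck_on_has_derivative[OF C1 z]]] .
    ultimately show "((\<lambda>y. t ^ m *\<^sub>R g (x0 + t *\<^sub>R (y - x0))) has_derivative blinfun_apply (?D y t))
        (at y within ball x e)"
      by (simp add: D[OF z] scaleR_blinfun.rep_eq mult.commute)
  next
    show "(\<lambda>t. t ^ m *\<^sub>R g (x0 + t *\<^sub>R (y - x0))) integrable_on cbox 0 1" if "y \<in> ball x e" for y
      using radial_integrand_integrable[OF contg, of y m] e that by auto
    show "continuous_on (ball x e \<times> cbox 0 1) (\<lambda>(y, t). ?D y t)"
      using continuous_on_radial_integrand[OF contD e(2), of "Suc m"] by simp
  qed (use e in auto)
  moreover have "at x within ball x e = at x"
    using e(1) by (intro at_within_open) auto
  moreover have "blinfun_apply (integral (cbox 0 1) (?D x))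
      = (\<lambda>v. radial_integral x0 (Suc m) (\<lambda>y. frechet_derivative g (at y) v) x)"
  proof (rule ext)
    fix v
    have "?D x integrable_on cbox 0 1"
      using radial_integrand_integrable[OF contD assms(2), of "Suc m"] by simp
    then have "blinfun_apply (integral (cbox 0 1) (?D x)) v = integral (cbox 0 1) (\<lambda>t. blinfun_apply (?D x t) v)"
      by (rule blinfun_apply_integral)
    also have "\<dots> = radial_integral x0 (Suc m) (\<lambda>y. frechet_derivative g (at y) v) x"
      unfolding radial_integral_def box_real
      using ray_in_domain[OF assms(2)] by (intro integral_cong) (simp add: D scaleR_blinfun.rep_eq)
    finally show "blinfun_apply (integral (cbox 0 1) (?D x)) v
      = radial_integral x0 (Suc m) (\<lambda>y. frechet_derivative g (at y) v) x" .
  qed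
  moreover have "(\<lambda>y. integral (cbox 0 1) (\<lambda>t. t ^ m *\<^sub>R g (x0 + t *\<^sub>R (y - x0)))) = radial_integral x0 m g"
    by (simp add: radial_integral_def fun_eq_iff)
  ultimately show ?thesis by simp
qed

lemma Ck_on_radial_integral:
  fixes g :: "'a \<Rightarrow> 'w::banach"
  assumes "Ck_on n U g"
  shows "Ck_on n U (radial_integral x0 m g)"
  using assms
proof (induction n arbitrary: g m)
  case 0
  then have "continuous_on U g" by simp
  then have "continuous_on (U \<times> cbox 0 1) (\<lambda>(x, t). t ^ m *\<^sub>R g (x0 + t *\<^sub>R (x - x0)))"
    using continuous_on_radial_integrand[OF _ order_refl] by simp
  from integral_continuous_on_param[OF this]
  show ?case by (simp add: radial_integral_def[abs_def])
next
  case (Suc n)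
  have "Ck_on (Suc 0) U g" using Suc.prems
    by (induction n) (auto dest: Ck_on_SucD simp del: Ck_on.simps)
  then show ?case
    using Suc by (intro Ck_on_SucI[OF open_domain radial_integral_has_derivative]) auto
qed

text \<open>
  The fundamental theorem of calculus for \<open>t ^ Suc m *\<^sub>R g (x0 + t *\<^sub>R (x - x0))\<close> on the unit interval.
\<close>

lemma radial_integral_by_parts:
  fixes g :: "'a \<Rightarrow> 'w::banach"
  assumes C1: "Ck_on (Suc 0) U g" and "x \<in> U"
  shows "real (Suc m) *\<^sub>R radial_integral x0 m g x
    + radial_integral x0 (Suc m) (\<lambda>y. frechet_derivative g (at y) (x - x0)) x = g x"
proof -
  let ?y = "\<lambda>t. x0 + t *\<^sub>R (x - x0)"
  let ?D = "\<lambda>y. frechet_derivative g (at y) (x - x0)"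
  have contg: "continuous_on U g" and contD: "continuous_on U ?D"
    using Ck_on_SucD[OF C1] C1 by auto
  have deriv: "((\<lambda>t. t ^ Suc m *\<^sub>R g (?y t)) has_vector_derivative
      (real (Suc m) *\<^sub>R t ^ m *\<^sub>R g (?y t) + t ^ Suc m *\<^sub>R ?D (?y t))) (at t within {0..1})"
    if "t \<in> {0..1}" for t
  proof -
    have y: "?y t \<in> U" using ray_in_domain assms(2) that by blast
    have "((\<lambda>t. ?y t) has_derivative (\<lambda>h. h *\<^sub>R (x - x0))) (at t within {0..1})"
      by (auto intro!: derivative_eq_intros)
    from has_derivative_compose[OF this Ck_on_has_derivative[OF C1 y]]
    have g: "((\<lambda>t. g (?y t)) has_vector_derivative ?D (?y t)) (at t within {0..1})"
      using linear_scale[OF has_derivative_linear[OF Ck_on_has_derivative[OF C1 y]]]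
      by (simp add: has_vector_derivative_def)
    have "((\<lambda>t. t ^ Suc m) has_field_derivative real (Suc m) * t ^ m) (at t within {0..1})"
      by (auto intro!: derivative_eq_intros simp del: power_Suc)
    from has_vector_derivative_scaleR[OF this g] show ?thesis by (simp add: add.commute)
  qed
  have "((\<lambda>t. real (Suc m) *\<^sub>R t ^ m *\<^sub>R g (?y t) + t ^ Suc m *\<^sub>R ?D (?y t)) has_integral
      1 ^ Suc m *\<^sub>R g (?y 1) - 0 ^ Suc m *\<^sub>R g (?y 0)) {0..1}"
    by (rule fundamental_theorem_of_calculus) (use deriv in auto)
  then have "integral {0..1} (\<lambda>t. real (Suc m) *\<^sub>R t ^ m *\<^sub>R g (?y t) + t ^ Suc m *\<^sub>R ?D (?y t)) = g x"
    by (auto dest: integral_unique)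
  moreover have "integral {0..1} (\<lambda>t. real (Suc m) *\<^sub>R t ^ m *\<^sub>R g (?y t) + t ^ Suc m *\<^sub>R ?D (?y t))
      = real (Suc m) *\<^sub>R radial_integral x0 m g x + radial_integral x0 (Suc m) ?D x"
    unfolding radial_integral_def
    using radial_integrand_integrable[OF contg assms(2)] radial_integrand_integrable[OF contD assms(2)]
    by (subst integral_add) (auto intro!: integrable_cmul simp del: of_nat_Suc power_Suc scaleR_scaleR)
  ultimately show ?thesis by simp
qed

end

section \<open>Exterior calculus of forms on the domain\<close>

lemma linear_basis_expansion:
  assumes "linear f"
  shows "f c = (\<Sum>b\<in>Basis. (c \<bullet> b) *\<^sub>R f b)"
proof -
  have "f c = f (\<Sum>b\<in>Basis. (c \<bullet> b) *\<^sub>R b)" by (simp add: euclidean_representation)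
  also have "\<dots> = (\<Sum>b\<in>Basis. (c \<bullet> b) *\<^sub>R f b)"
    using assms by (simp add: linear_sum linear_scale)
  finally show ?thesis .
qed

lemma alternating_linear_case_nat:
  assumes "alternating_multilinear (Suc k) f"
  shows "linear (\<lambda>c. f (case_nat c w))"
proof -
  have "(case_nat undefined w)(0 := c) = case_nat c w" for c
    by (auto simp: fun_eq_iff split: nat.split)
  then show ?thesis using alternating_linear[OF assms, of 0 "case_nat undefined w"] by simp
qed

lemma alternating_compose_linear:
  fixes f :: "(nat \<Rightarrow> 'a::real_vector) \<Rightarrow> 'b::real_vector" and L :: "'b \<Rightarrow> 'c::real_vector"
  assumes "linear L" and f: "alternating_multilinear k f"
  shows "alternating_multilinear k (\<lambda>w. L (f w))"
  unfolding alternating_multilinear_def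
proof (intro conjI allI impI)
  fix v w :: "nat \<Rightarrow> 'a" assume "\<forall>i<k. v i = w i"
  then show "L (f v) = L (f w)" using alternating_cong[OF f, of v w] by simp
next
  fix v :: "nat \<Rightarrow> 'a" and i assume "i < k"
  from linear_compose[OF alternating_linear[OF f this] assms(1)]
  show "linear (\<lambda>u. L (f (v(i := u))))" by (simp add: o_def)
next
  fix v :: "nat \<Rightarrow> 'a" and i j assume "i < k" "j < k" "i \<noteq> j" "v i = v j"
  from alternating_eq_0[OF f this] show "L (f v) = 0" using linear_0[OF assms(1)] by simp
qed

lemma alternating_add_scaleR:
  assumes f: "alternating_multilinear k f" and g: "alternating_multilinear k g"
  shows "alternating_multilinear k (\<lambda>w. f w + c *\<^sub>R g w)"
  unfolding alternating_multilinear_def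
proof (intro conjI allI impI)
  fix v w :: "nat \<Rightarrow> 'a" assume "\<forall>i<k. v i = w i"
  then show "f v + c *\<^sub>R g v = f w + c *\<^sub>R g w"
    using alternating_cong[OF f, of v w] alternating_cong[OF g, of v w] by simp
next
  fix v :: "nat \<Rightarrow> 'a" and i assume "i < k"
  then show "linear (\<lambda>u. f (v(i := u)) + c *\<^sub>R g (v(i := u)))"
    using alternating_linear[OF f] alternating_linear[OF g]
    by (intro linear_compose_add linear_compose_scale_right)
next
  fix v :: "nat \<Rightarrow> 'a" and i j assume "i < k" "j < k" "i \<noteq> j" "v i = v j"
  then show "f v + c *\<^sub>R g v = 0" using alternating_eq_0[OF f] alternating_eq_0[OF g] by simp
qed

lemma forms_alternating: "\<omega> \<in> forms U k \<Longrightarrow> x \<in> U \<Longrightarrow> alternating_multilinear k (\<omega> x)"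
  by (simp add: forms_def)

lemma forms_smooth: "\<omega> \<in> forms U k \<Longrightarrow> smooth_on U (\<lambda>x. \<omega> x v)"
  by (simp add: forms_def)

lemma forms_Ck_on: "\<omega> \<in> forms U k \<Longrightarrow> Ck_on m U (\<lambda>x. \<omega> x v)"
  by (simp add: forms_def smooth_on_def)

lemma forms_has_derivative:
  "\<omega> \<in> forms U k \<Longrightarrow> x \<in> U \<Longrightarrow>
    ((\<lambda>y. \<omega> y v) has_derivative frechet_derivative (\<lambda>y. \<omega> y v) (at x)) (at x)"
  by (rule smooth_on_has_derivative[OF forms_smooth])

lemma zero_in_forms: "open U \<Longrightarrow> 0 \<in> forms U k"
  by (auto simp: forms_def alternating_multilinear_def smooth_on_def linear_0 Ck_on_const
      intro: linear_zero)

lemma forms_add_scaleR: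
  assumes "open U" and "\<omega> \<in> forms U k" and "\<eta> \<in> forms U k"
  shows "(\<lambda>x v. \<omega> x v + c *\<^sub>R \<eta> x v) \<in> forms U k"
  using assms by (auto simp: forms_def smooth_on_def
      intro!: alternating_add_scaleR Ck_on_add Ck_on_scaleR_const)

lemma forms_add:
  assumes "open U" and "\<omega> \<in> forms U k" and "\<eta> \<in> forms U k"
  shows "\<omega> + \<eta> \<in> forms U k"
proof -
  have "\<omega> + \<eta> = (\<lambda>x v. \<omega> x v + 1 *\<^sub>R \<eta> x v)" by (simp add: fun_eq_iff)
  then show ?thesis using forms_add_scaleR[OF assms, of 1] by simp
qed

lemma forms_diff:
  assumes "open U" and "\<omega> \<in> forms U k" and "\<eta> \<in> forms U k"
  shows "\<omega> - \<eta> \<in> forms U k"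
proof -
  have "\<omega> - \<eta> = (\<lambda>x v. \<omega> x v + (-1) *\<^sub>R \<eta> x v)" by (simp add: fun_eq_iff)
  then show ?thesis using forms_add_scaleR[OF assms, of "-1"] by simp
qed

lemma frechet_derivative_cong:
  assumes "open U" and "x \<in> U" and "(f has_derivative f') (at x)" and "\<And>y. y \<in> U \<Longrightarrow> f y = g y"
  shows "frechet_derivative g (at x) = f'"
  using has_derivative_transform_within_open[OF assms(3,1,2,4)] frechet_derivative_at by metis

text \<open>
  Differentiation in the base point commutes with the linear conditions on the tangent vectors.
\<close>

lemma alternating_frechet_derivative:
  assumes "open U" and \<omega>: "\<omega> \<in> forms U k" and x: "x \<in> U"
  shows "alternating_multilinear k (\<lambda>w. frechet_derivative (\<lambda>y. \<omega> y w) (at x) u)"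
  unfolding alternating_multilinear_def
proof (intro conjI allI impI)
  fix v w :: "nat \<Rightarrow> 'a" assume "\<forall>i<k. v i = w i"
  then have "\<omega> y v = \<omega> y w" if "y \<in> U" for y
    using that by (intro alternating_cong[OF forms_alternating[OF \<omega>]]) auto
  then show "frechet_derivative (\<lambda>y. \<omega> y v) (at x) u = frechet_derivative (\<lambda>y. \<omega> y w) (at x) u"
    using frechet_derivative_cong[OF assms(1) x forms_has_derivative[OF \<omega> x]] by metis
next
  fix v :: "nat \<Rightarrow> 'a" and i assume i: "i < k"
  note lin = alternating_linear[OF forms_alternating[OF \<omega>] i]
  show "linear (\<lambda>c. frechet_derivative (\<lambda>y. \<omega> y (v(i := c))) (at x) u)"
  proof (rule linearI)
    fix a b :: 'a
    have "frechet_derivative (\<lambda>y. \<omega> y (v(i := a + b))) (at x)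
        = (\<lambda>h. frechet_derivative (\<lambda>y. \<omega> y (v(i := a))) (at x) h + frechet_derivative (\<lambda>y. \<omega> y (v(i := b))) (at x) h)"
      using forms_has_derivative[OF \<omega> x] linear_add[OF lin]
      by (intro frechet_derivative_cong[OF assms(1) x has_derivative_add]) auto
    then show "frechet_derivative (\<lambda>y. \<omega> y (v(i := a + b))) (at x) u
        = frechet_derivative (\<lambda>y. \<omega> y (v(i := a))) (at x) u + frechet_derivative (\<lambda>y. \<omega> y (v(i := b))) (at x) u"
      by simp
  next
    fix r :: real and a :: 'a
    have "frechet_derivative (\<lambda>y. \<omega> y (v(i := r *\<^sub>R a))) (at x)
        = (\<lambda>h. r *\<^sub>R frechet_derivative (\<lambda>y. \<omega> y (v(i := a))) (at x) h)"
      using forms_has_derivative[OF \<omega> x] linear_scale[OF lin]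
      by (intro frechet_derivative_cong[OF assms(1) x has_derivative_scaleR_right]) auto
    then show "frechet_derivative (\<lambda>y. \<omega> y (v(i := r *\<^sub>R a))) (at x) u
        = r *\<^sub>R frechet_derivative (\<lambda>y. \<omega> y (v(i := a))) (at x) u"
      by simp
  qed
next
  fix v :: "nat \<Rightarrow> 'a" and i j assume ij: "i < k" "j < k" "i \<noteq> j" "v i = v j"
  have "frechet_derivative (\<lambda>y. \<omega> y v) (at x) = (\<lambda>h. 0)"
    using alternating_eq_0[OF forms_alternating[OF \<omega>] ij]
    by (intro frechet_derivative_cong[OF assms(1) x has_derivative_const[of 0]]) simp
  then show "frechet_derivative (\<lambda>y. \<omega> y v) (at x) u = 0" by simp
qed

lemma ext_d_in_forms:
  assumes "open U" and \<omega>: "\<omega> \<in> forms U k"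
  shows "ext_d k \<omega> \<in> forms U (Suc k)"
  unfolding forms_def
proof (intro CollectI conjI ballI allI)
  show "alternating_multilinear (Suc k) (ext_d k \<omega> x)" if x: "x \<in> U" for x
    unfolding ext_d_def
    by (intro alternating_shuffle_sum alternating_frechet_derivative[OF assms x]
        has_derivative_linear[OF forms_has_derivative[OF \<omega> x]])
  show "smooth_on U (\<lambda>x. ext_d k \<omega> x v)" for v
    unfolding ext_d_def smooth_on_def
    using smooth_on_frechet_derivative[OF forms_smooth[OF \<omega>]]
    by (auto simp: smooth_on_def intro!: Ck_on_sum Ck_on_scaleR_const assms(1))
qed

lemma wedge1_in_forms:
  assumes "open U" and A: "A \<in> forms U 1" and \<omega>: "\<omega> \<in> forms U k"
  shows "wedge1 k A \<omega> \<in> forms U (Suc k)"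
  unfolding forms_def
proof (intro CollectI conjI ballI allI)
  fix x assume x: "x \<in> U"
  have "A x ((\<lambda>_. 0)(0 := u)) = A x (\<lambda>_. u)" for u
    by (rule alternating_cong[OF forms_alternating[OF A x]]) simp
  then have linA: "linear (\<lambda>u. A x (\<lambda>_. u))"
    using alternating_linear[OF forms_alternating[OF A x], of 0 "\<lambda>_. 0"] by simp
  have "linear (\<lambda>u. blinfun_apply (A x (\<lambda>_. u)) c)" for c
    using linear_compose[OF linA bounded_linear.linear[OF blinfun.bounded_linear_left[of c]]]
    by (simp add: o_def)
  then show "alternating_multilinear (Suc k) (wedge1 k A \<omega> x)"
    unfolding wedge1_def
    by (intro alternating_shuffle_sum alternating_compose_linear[OF _ forms_alternating[OF \<omega> x]]
        bounded_linear.linear[OF blinfun.bounded_linear_right])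
next
  show "smooth_on U (\<lambda>x. wedge1 k A \<omega> x v)" for v
    unfolding wedge1_def smooth_on_def
    using forms_Ck_on[OF A] forms_Ck_on[OF \<omega>]
    by (auto intro!: Ck_on_sum Ck_on_scaleR_const Ck_on_bounded_bilinear[OF assms(1) bounded_bilinear_blinfun_apply] assms(1))
qed

text \<open>
  The second derivatives are symmetric in the two directions of differentiation, whereas the signs
  of the two omissions are antisymmetric.
\<close>

lemma ext_d_ext_d:
  fixes \<omega> :: "('a::euclidean_space, 'w::euclidean_space) form"
  assumes "open U" and \<omega>: "\<omega> \<in> forms U k" and x: "x \<in> U"
  shows "ext_d (Suc k) (ext_d k \<omega>) x v = 0"
proof -
  define S where "S a b w = frechet_derivative (\<lambda>y. frechet_derivative (\<lambda>z. \<omega> z w) (at y) b) (at x) a" for a b w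
  have "S a b w = S b a w" for a b w
    unfolding S_def by (rule frechet_derivative_symmetric[OF assms(1) x forms_Ck_on[OF \<omega>]])
  note zero = double_shuffle_sum_eq_0[of S, OF this]
  have "frechet_derivative (\<lambda>y. ext_d k \<omega> y w) (at x) = (\<lambda>u. \<Sum>j\<le>k. (-1) ^ j *\<^sub>R S u (w j) (omit j w))" for w
    unfolding ext_d_def S_def
    by (intro frechet_derivative_at[symmetric] has_derivative_sum has_derivative_scaleR_right
        smooth_on_has_derivative[OF smooth_on_frechet_derivative[OF forms_smooth[OF \<omega>]] x])
  then have "ext_d (Suc k) (ext_d k \<omega>) x v
      = (\<Sum>i\<le>Suc k. (-1) ^ i *\<^sub>R (\<Sum>j\<le>k. (-1) ^ j *\<^sub>R S (v i) (omit i v j) (omit j (omit i v))))"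
    by (simp add: ext_d_def[of "Suc k"] del: sum.atMost_Suc)
  then show ?thesis by (simp only: zero)
qed

lemma ext_d_cong:
  assumes "open U" and "\<omega> \<in> forms U k" and "forms_eq U \<omega> \<eta>"
  shows "forms_eq U (ext_d k \<omega>) (ext_d k \<eta>)"
proof -
  have "frechet_derivative (\<lambda>y. \<eta> y w) (at x) = frechet_derivative (\<lambda>y. \<omega> y w) (at x)" if "x \<in> U" for x w
    using assms(3)
    by (intro frechet_derivative_cong[OF assms(1) that forms_has_derivative[OF assms(2) that]])
      (simp add: forms_eq_def)
  then show ?thesis by (simp add: forms_eq_def ext_d_def)
qed

lemma ext_d_add:
  assumes "\<omega> \<in> forms U k" and "\<eta> \<in> forms U k"
  shows "forms_eq U (ext_d k (\<omega> + \<eta>)) (ext_d k \<omega> + ext_d k \<eta>)"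
proof -
  have "frechet_derivative (\<lambda>y. \<omega> y w + \<eta> y w) (at x)
      = (\<lambda>u. frechet_derivative (\<lambda>y. \<omega> y w) (at x) u + frechet_derivative (\<lambda>y. \<eta> y w) (at x) u)" if "x \<in> U" for x w
    using that assms
    by (intro frechet_derivative_at[symmetric] has_derivative_add forms_has_derivative)
  then show ?thesis
    by (simp add: forms_eq_def ext_d_def fun_eq_iff scaleR_add_right sum.distrib)
qed

lemma ext_d_diff:
  assumes "\<omega> \<in> forms U k" and "\<eta> \<in> forms U k"
  shows "forms_eq U (ext_d k (\<omega> - \<eta>)) (ext_d k \<omega> - ext_d k \<eta>)"
proof -
  have "frechet_derivative (\<lambda>y. \<omega> y w - \<eta> y w) (at x)
      = (\<lambda>u. frechet_derivative (\<lambda>y. \<omega> y w) (at x) u - frechet_derivative (\<lambda>y. \<eta> y w) (at x) u)" if "x \<in> U" for x w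
    using that assms
    by (intro frechet_derivative_at[symmetric] has_derivative_diff forms_has_derivative)
  then show ?thesis
    by (simp add: forms_eq_def ext_d_def fun_eq_iff scaleR_diff_right sum_subtractf)
qed

lemma wedge1_add: "wedge1 k A (\<omega> + \<eta>) = wedge1 k A \<omega> + wedge1 k A \<eta>"
  by (simp add: wedge1_def fun_eq_iff blinfun.add_right scaleR_add_right sum.distrib)

section \<open>The homotopy operator\<close>

context star_domain
begin

lemma homotopy_op_eq_radial_integral:
  "homotopy_op x0 (Suc p) \<omega> x w = radial_integral x0 p (\<lambda>y. \<omega> y (case_nat (x - x0) w)) x"
  by (simp add: homotopy_op_def radial_integral_def contract_def)

text \<open>
  Expanding the first slot in a basis separates the two ways in which \<open>x\<close> enters the homotopy
  operator: as a linear factor \<open>x - x0\<close>, and through radial integrals with a constant first slot.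
  Smoothness and the derivative of the homotopy operator then come from the product rule.
\<close>

lemma radial_integral_case_nat_expansion:
  fixes \<omega> :: "('a, 'w::banach) form"
  assumes \<omega>: "\<omega> \<in> forms U (Suc p)" and "x \<in> U"
  shows "radial_integral x0 m (\<lambda>y. \<omega> y (case_nat c w)) x
    = (\<Sum>b\<in>Basis. (c \<bullet> b) *\<^sub>R radial_integral x0 m (\<lambda>y. \<omega> y (case_nat b w)) x)"
proof -
  have "radial_integral x0 m (\<lambda>y. \<omega> y (case_nat c w)) x
      = radial_integral x0 m (\<lambda>y. \<Sum>b\<in>Basis. (c \<bullet> b) *\<^sub>R \<omega> y (case_nat b w)) x"
    by (intro radial_integral_cong[OF assms(2)]
        linear_basis_expansion alternating_linear_case_nat[OF forms_alternating[OF \<omega>]])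
  also have "\<dots> = (\<Sum>b\<in>Basis. radial_integral x0 m (\<lambda>y. (c \<bullet> b) *\<^sub>R \<omega> y (case_nat b w)) x)"
    using smooth_on_imp_continuous_on[OF forms_smooth[OF \<omega>]]
    by (intro radial_integral_sum assms(2) continuous_intros) auto
  finally show ?thesis by (simp add: radial_integral_scaleR)
qed

lemma homotopy_op_in_forms:
  fixes \<omega> :: "('a, 'w::banach) form"
  assumes \<omega>: "\<omega> \<in> forms U (Suc p)"
  shows "homotopy_op x0 (Suc p) \<omega> \<in> forms U p"
  unfolding forms_def
proof (intro CollectI conjI ballI allI)
  fix x assume x: "x \<in> U"
  note alt = alternating_case_nat[OF forms_alternating[OF \<omega>], of _ "x - x0"]
  note cont = smooth_on_imp_continuous_on[OF forms_smooth[OF \<omega>]]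
  show "alternating_multilinear p (homotopy_op x0 (Suc p) \<omega> x)"
    unfolding alternating_multilinear_def homotopy_op_eq_radial_integral
  proof (intro conjI allI impI)
    fix v w :: "nat \<Rightarrow> 'a" assume "\<forall>i<p. v i = w i"
    then show "radial_integral x0 p (\<lambda>y. \<omega> y (case_nat (x - x0) v)) x
        = radial_integral x0 p (\<lambda>y. \<omega> y (case_nat (x - x0) w)) x"
      by (intro radial_integral_cong x alternating_cong[OF alt]) auto
  next
    fix v :: "nat \<Rightarrow> 'a" and i assume i: "i < p"
    note lin = alternating_linear[OF alt i]
    show "linear (\<lambda>u. radial_integral x0 p (\<lambda>y. \<omega> y (case_nat (x - x0) (v(i := u)))) x)"
    proof (rule linearI)
      fix a b :: 'a
      have "radial_integral x0 p (\<lambda>y. \<omega> y (case_nat (x - x0) (v(i := a + b)))) x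
        = radial_integral x0 p (\<lambda>y. \<omega> y (case_nat (x - x0) (v(i := a))) + \<omega> y (case_nat (x - x0) (v(i := b)))) x"
        by (intro radial_integral_cong x linear_add[OF lin])
      then show "radial_integral x0 p (\<lambda>y. \<omega> y (case_nat (x - x0) (v(i := a + b)))) x
        = radial_integral x0 p (\<lambda>y. \<omega> y (case_nat (x - x0) (v(i := a)))) x
          + radial_integral x0 p (\<lambda>y. \<omega> y (case_nat (x - x0) (v(i := b)))) x"
        by (simp add: radial_integral_add cont x)
    next
      fix r :: real and a :: 'a
      have "radial_integral x0 p (\<lambda>y. \<omega> y (case_nat (x - x0) (v(i := r *\<^sub>R a)))) x
        = radial_integral x0 p (\<lambda>y. r *\<^sub>R \<omega> y (case_nat (x - x0) (v(i := a)))) x"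
        by (intro radial_integral_cong x linear_scale[OF lin])
      then show "radial_integral x0 p (\<lambda>y. \<omega> y (case_nat (x - x0) (v(i := r *\<^sub>R a)))) x
        = r *\<^sub>R radial_integral x0 p (\<lambda>y. \<omega> y (case_nat (x - x0) (v(i := a)))) x"
        by (simp add: radial_integral_scaleR)
    qed
  next
    fix v :: "nat \<Rightarrow> 'a" and i j assume ij: "i < p" "j < p" "i \<noteq> j" "v i = v j"
    have "radial_integral x0 p (\<lambda>y. \<omega> y (case_nat (x - x0) v)) x = radial_integral x0 p (\<lambda>y. 0) x"
      by (intro radial_integral_cong x alternating_eq_0[OF alt ij])
    then show "radial_integral x0 p (\<lambda>y. \<omega> y (case_nat (x - x0) v)) x = 0"
      by (simp add: radial_integral_def)
  qed
next
  fix w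
  have "Ck_on m U (\<lambda>x. homotopy_op x0 (Suc p) \<omega> x w)" for m
  proof (rule Ck_on_cong[OF open_domain])
    show "Ck_on m U (\<lambda>x. \<Sum>b\<in>Basis. (x \<bullet> b - x0 \<bullet> b) *\<^sub>R radial_integral x0 p (\<lambda>y. \<omega> y (case_nat b w)) x)"
      using Ck_on_add[OF open_domain Ck_on_bounded_linear[OF open_domain bounded_linear_inner_left]
          Ck_on_const[OF open_domain], of m _ "- (x0 \<bullet> _)"]
      by (intro Ck_on_sum[OF open_domain] Ck_on_bounded_bilinear[OF open_domain bounded_bilinear_scaleR]
          Ck_on_radial_integral forms_Ck_on[OF \<omega>]) simp
    show "(\<Sum>b\<in>Basis. (x \<bullet> b - x0 \<bullet> b) *\<^sub>R radial_integral x0 p (\<lambda>y. \<omega> y (case_nat b w)) x)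
        = homotopy_op x0 (Suc p) \<omega> x w" if "x \<in> U" for x
      using radial_integral_case_nat_expansion[OF \<omega> that, of p "x - x0" w]
      by (simp add: homotopy_op_eq_radial_integral inner_diff_left)
  qed
  then show "smooth_on U (\<lambda>x. homotopy_op x0 (Suc p) \<omega> x w)" by (simp add: smooth_on_def)
qed

text \<open>
  The first summand differentiates the linear factor \<open>x - x0\<close>, the second one the integrand.
\<close>

lemma homotopy_op_has_derivative:
  fixes \<omega> :: "('a, 'w::banach) form"
  assumes \<omega>: "\<omega> \<in> forms U (Suc p)" and x: "x \<in> U"
  shows "((\<lambda>y. homotopy_op x0 (Suc p) \<omega> y w) has_derivative
    (\<lambda>u. radial_integral x0 p (\<lambda>y. \<omega> y (case_nat u w)) x
      + radial_integral x0 (Suc p) (\<lambda>y. frechet_derivative (\<lambda>z. \<omega> z (case_nat (x - x0) w)) (at y) u) x)) (at x)"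
proof -
  let ?R = "\<lambda>b. radial_integral x0 p (\<lambda>y. \<omega> y (case_nat b w))"
  let ?D = "\<lambda>b u y. frechet_derivative (\<lambda>z. \<omega> z (case_nat b w)) (at y) u"
  let ?R' = "\<lambda>b u. radial_integral x0 (Suc p) (?D b u)"
  have "((\<lambda>y. \<Sum>b\<in>Basis. ((y - x0) \<bullet> b) *\<^sub>R ?R b y) has_derivative
      (\<lambda>u. \<Sum>b\<in>Basis. ((x - x0) \<bullet> b) *\<^sub>R ?R' b u x + (u \<bullet> b) *\<^sub>R ?R b x)) (at x)"
  proof (intro has_derivative_sum)
    fix b :: 'a
    have "((\<lambda>y. (y - x0) \<bullet> b) has_derivative (\<lambda>u. u \<bullet> b)) (at x)"
      by (auto intro!: derivative_eq_intros)
    from has_derivative_scaleR[OF this radial_integral_has_derivative[OF forms_Ck_on[OF \<omega>] x]]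
    show "((\<lambda>y. ((y - x0) \<bullet> b) *\<^sub>R ?R b y) has_derivative
      (\<lambda>u. ((x - x0) \<bullet> b) *\<^sub>R ?R' b u x + (u \<bullet> b) *\<^sub>R ?R b x)) (at x)" .
  qed
  moreover have "(\<Sum>b\<in>Basis. ((x - x0) \<bullet> b) *\<^sub>R ?R' b u x + (u \<bullet> b) *\<^sub>R ?R b x)
      = ?R u x + ?R' (x - x0) u x" for u
  proof -
    have "?R' (x - x0) u x = radial_integral x0 (Suc p) (\<lambda>y. \<Sum>b\<in>Basis. ((x - x0) \<bullet> b) *\<^sub>R ?D b u y) x"
      by (intro radial_integral_cong[OF x] linear_basis_expansion
          alternating_linear_case_nat[OF alternating_frechet_derivative[OF open_domain \<omega>]])
    also have "\<dots> = (\<Sum>b\<in>Basis. radial_integral x0 (Suc p) (\<lambda>y. ((x - x0) \<bullet> b) *\<^sub>R ?D b u y) x)"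
      using smooth_on_imp_continuous_on[OF smooth_on_frechet_derivative[OF forms_smooth[OF \<omega>]]]
      by (intro radial_integral_sum x continuous_intros) auto
    finally have "?R' (x - x0) u x = (\<Sum>b\<in>Basis. ((x - x0) \<bullet> b) *\<^sub>R ?R' b u x)"
      by (simp only: radial_integral_scaleR)
    then show ?thesis
      using radial_integral_case_nat_expansion[OF \<omega> x, of p u w]
      by (simp only: sum.distrib add.commute)
  qed
  ultimately have "((\<lambda>y. \<Sum>b\<in>Basis. ((y - x0) \<bullet> b) *\<^sub>R ?R b y) has_derivative
      (\<lambda>u. ?R u x + ?R' (x - x0) u x)) (at x)" by simp
  then show ?thesis
    by (rule has_derivative_transform_within_open[OF _ open_domain x])
      (simp only: homotopy_op_eq_radial_integral radial_integral_case_nat_expansion[OF \<omega>, of _ p "_ - x0", symmetric])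
qed

text \<open>
  In \<open>d H \<omega>\<close>, differentiating the linear factor gives \<open>Suc p\<close> equal summands, because moving \<open>v i\<close>
  back to its place costs the sign \<open>(-1) ^ i\<close> that the summand already carries. Differentiating the
  integrand gives the terms of \<open>H d \<omega>\<close> that omit some \<open>v i\<close>, with opposite sign. What remains of
  \<open>H d \<omega>\<close> is the radial derivative; by integration by parts along the ray, it and the \<open>Suc p\<close>
  equal terms add up to \<open>\<omega>\<close>.
\<close>

theorem homotopy_formula:
  fixes \<omega> :: "('a, 'w::banach) form"
  assumes \<omega>: "\<omega> \<in> forms U (Suc p)" and x: "x \<in> U"
  shows "ext_d p (homotopy_op x0 (Suc p) \<omega>) x v + homotopy_op x0 (Suc (Suc p)) (ext_d (Suc p) \<omega>) x v = \<omega> x v"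
proof -
  let ?K = "x - x0"
  let ?R = "radial_integral x0 p (\<lambda>y. \<omega> y v) x"
  let ?D = "\<lambda>w u y. frechet_derivative (\<lambda>z. \<omega> z w) (at y) u"
  let ?T = "\<lambda>i. radial_integral x0 (Suc p) (?D (case_nat ?K (omit i v)) (v i)) x"
  note cont = smooth_on_imp_continuous_on[OF smooth_on_frechet_derivative[OF forms_smooth[OF \<omega>]]]
  have front: "radial_integral x0 p (\<lambda>y. \<omega> y (case_nat (v i) (omit i v))) x = (-1) ^ i *\<^sub>R ?R" if "i \<le> p" for i
  proof -
    have "\<omega> y (case_nat (v i) (omit i v)) = (-1) ^ i *\<^sub>R \<omega> y v" if "y \<in> U" for y
      using alternating_insert_at[OF forms_alternating[OF \<omega> that], of i "v i" "omit i v"] \<open>i \<le> p\<close>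
      by (simp add: insert_at_omit)
    then show ?thesis
      unfolding radial_integral_scaleR[symmetric] by (intro radial_integral_cong x)
  qed
  have "ext_d p (homotopy_op x0 (Suc p) \<omega>) x v
      = (\<Sum>i\<le>p. (-1) ^ i *\<^sub>R (radial_integral x0 p (\<lambda>y. \<omega> y (case_nat (v i) (omit i v))) x + ?T i))"
    unfolding ext_d_def frechet_derivative_at[OF homotopy_op_has_derivative[OF \<omega> x], symmetric] ..
  also have "\<dots> = (\<Sum>i\<le>p. ?R + (-1) ^ i *\<^sub>R ?T i)"
    by (intro sum.cong) (simp_all add: front scaleR_add_right power_mult_distrib[symmetric])
  finally have dH: "ext_d p (homotopy_op x0 (Suc p) \<omega>) x v = real (Suc p) *\<^sub>R ?R + (\<Sum>i\<le>p. (-1) ^ i *\<^sub>R ?T i)"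
    by (simp add: sum.distrib sum_constant_scaleR del: of_nat_Suc)
  let ?v = "case_nat ?K v"
  have "homotopy_op x0 (Suc (Suc p)) (ext_d (Suc p) \<omega>) x v
      = radial_integral x0 (Suc p) (\<lambda>y. \<Sum>i\<le>Suc p. (-1) ^ i *\<^sub>R ?D (omit i ?v) (?v i) y) x"
    by (simp add: homotopy_op_eq_radial_integral ext_d_def del: sum.atMost_Suc)
  also have "\<dots> = (\<Sum>i\<le>Suc p. radial_integral x0 (Suc p) (\<lambda>y. (-1) ^ i *\<^sub>R ?D (omit i ?v) (?v i) y) x)"
    by (intro radial_integral_sum x continuous_intros cont) auto
  also have "\<dots> = radial_integral x0 (Suc p) (?D v ?K) x - (\<Sum>i\<le>p. (-1) ^ i *\<^sub>R ?T i)"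
    unfolding sum.atMost_Suc_shift radial_integral_scaleR
    by (simp add: omit_0_case_nat omit_Suc_case_nat sum_negf)
  finally show ?thesis
    unfolding dH using radial_integral_by_parts[OF forms_Ck_on[OF \<omega>] x, of p v] by simp
qed

text \<open>
  Contracting once more with \<open>x - x0\<close> repeats an argument of an alternating map. At the centre the
  vector \<open>x - x0\<close> itself vanishes.
\<close>

lemma homotopy_op_antiexact:
  fixes \<omega> :: "('a, 'w::banach) form"
  assumes \<omega>: "\<omega> \<in> forms U (Suc p)" and "p > 0"
  shows "homotopy_op x0 (Suc p) \<omega> \<in> antiexact_forms U x0 p"
proof -
  have "homotopy_op x0 (Suc p) \<omega> x (case_nat (x - x0) w) = 0" if x: "x \<in> U" for x w
  proof -
    have "homotopy_op x0 (Suc p) \<omega> x (case_nat (x - x0) w) = radial_integral x0 p (\<lambda>y. 0) x"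
      unfolding homotopy_op_eq_radial_integral
      using assms(2) by (intro radial_integral_cong x alternating_eq_0[OF forms_alternating[OF \<omega>], of _ 0 1]) auto
    then show ?thesis by (simp add: radial_integral_def)
  qed
  moreover have "homotopy_op x0 (Suc p) \<omega> x0 w = 0" for w
  proof -
    have "homotopy_op x0 (Suc p) \<omega> x0 w = radial_integral x0 p (\<lambda>y. 0) x0"
      unfolding homotopy_op_eq_radial_integral
      using linear_0[OF alternating_linear_case_nat[OF forms_alternating[OF \<omega>]]]
      by (intro radial_integral_cong centre) simp
    then show ?thesis by (simp add: radial_integral_def)
  qed
  ultimately show ?thesis
    using homotopy_op_in_forms[OF \<omega>]
    by (simp add: antiexact_forms_def forms_eq_def contract_def fun_eq_iff)
qed

text \<open>
  On the ray, \<open>t *\<^sub>R (x - x0)\<close> is the value of the radial field at the point with parameter \<open>t\<close>,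
  so the integrand vanishes for \<open>t > 0\<close>; at \<open>t = 0\<close> it vanishes since \<open>\<omega> x0 = 0\<close>.
\<close>

lemma homotopy_op_eq_0_if_antiexact:
  fixes \<omega> :: "('a, 'w::banach) form"
  assumes \<omega>: "\<omega> \<in> antiexact_forms U x0 (Suc p)" and x: "x \<in> U"
  shows "homotopy_op x0 (Suc p) \<omega> x v = 0"
proof -
  have forms: "\<omega> \<in> forms U (Suc p)" and radial: "\<And>y w. y \<in> U \<Longrightarrow> \<omega> y (case_nat (y - x0) w) = 0"
    and zero: "\<omega> x0 = 0"
    using \<omega> by (auto simp: antiexact_forms_def forms_eq_def contract_def fun_eq_iff)
  have "\<omega> (x0 + t *\<^sub>R (x - x0)) (case_nat (x - x0) v) = 0" if t: "t \<in> {0..1}" for t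
  proof (cases "t = 0")
    case True
    then show ?thesis by (simp add: zero)
  next
    case False
    let ?y = "x0 + t *\<^sub>R (x - x0)"
    have y: "?y \<in> U" using ray_in_domain x t by blast
    have "t *\<^sub>R \<omega> ?y (case_nat (x - x0) v) = \<omega> ?y (case_nat (t *\<^sub>R (x - x0)) v)"
      using linear_scale[OF alternating_linear_case_nat[OF forms_alternating[OF forms y]]] by simp
    also have "\<dots> = 0" using radial[OF y, of v] by simp
    finally show ?thesis using False by simp
  qed
  then have "homotopy_op x0 (Suc p) \<omega> x v = integral {0..1} (\<lambda>t::real. 0::'w)"
    unfolding homotopy_op_eq_radial_integral radial_integral_def
    by (intro integral_cong) simp
  then show ?thesis by simp
qed

end

section \<open>Splitting the inhomogeneous equation\<close>

context star_domain
begin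

lemma exact_part_plus_antiexact_part:
  fixes J :: "('a, 'w::banach) form"
  assumes "J \<in> forms U (k + 1)"
  shows "forms_eq U (exact_part x0 (k + 1) J + antiexact_part x0 (k + 1) J) J"
  using homotopy_formula[of J k] assms
  by (simp add: forms_eq_def exact_part_def antiexact_part_def fun_eq_iff)

lemma antiexact_part_antiexact:
  fixes J :: "('a, 'w::banach) form"
  assumes "J \<in> forms U (k + 1)"
  shows "antiexact_part x0 (k + 1) J \<in> antiexact_forms U x0 (k + 1)"
  using homotopy_op_antiexact[of "ext_d (Suc k) J" "Suc k"] ext_d_in_forms[OF open_domain, of J "Suc k"] assms
  by (simp add: antiexact_part_def)

lemma ext_d_exact_part:
  fixes J :: "('a, 'w::euclidean_space) form"
  assumes "J \<in> forms U (k + 1)" and "x \<in> U"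
  shows "ext_d (k + 1) (exact_part x0 (k + 1) J) x v = 0"
  using ext_d_ext_d[OF open_domain homotopy_op_in_forms[of J k] assms(2)] assms(1)
  by (simp add: exact_part_def)

lemma exact_part_in_forms:
  fixes J :: "('a, 'w::banach) form"
  assumes "J \<in> forms U (k + 1)"
  shows "exact_part x0 (k + 1) J \<in> forms U (k + 1)"
  using ext_d_in_forms[OF open_domain homotopy_op_in_forms[of J k]] assms
  by (simp add: exact_part_def)

text \<open>
  If \<open>J - \<alpha>\<close> is closed, then \<open>H d J = H d \<alpha>\<close>, and the homotopy formula reduces the right-hand side
  to \<open>\<alpha>\<close> because \<open>H \<alpha> = 0\<close>. This identifies \<open>A \<and> \<phi>2\<close> in the converse part of the main result.
\<close>

theorem antiexact_part_unique:
  fixes J :: "('a, 'w::banach) form"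
  assumes J: "J \<in> forms U (k + 1)"
    and \<alpha>: "\<alpha> \<in> antiexact_forms U x0 (k + 1)"
    and closed: "forms_eq U (ext_d (k + 1) (J - \<alpha>)) 0"
  shows "forms_eq U \<alpha> (antiexact_part x0 (k + 1) J)"
proof -
  have \<alpha>_form: "\<alpha> \<in> forms U (k + 1)" using \<alpha> by (simp add: antiexact_forms_def)
  have H0: "homotopy_op x0 (Suc k) \<alpha> x v = 0" if "x \<in> U" for x v
    using homotopy_op_eq_0_if_antiexact[of \<alpha> k x v] \<alpha> that by simp
  have "frechet_derivative (\<lambda>y. homotopy_op x0 (Suc k) \<alpha> y w) (at x) = (\<lambda>h. 0)" if "x \<in> U" for x w
    by (rule frechet_derivative_cong[OF open_domain that has_derivative_const[of 0]]) (simp add: H0)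
  then have dH0: "ext_d k (homotopy_op x0 (Suc k) \<alpha>) x v = 0" if "x \<in> U" for x v
    using that by (simp add: ext_d_def)
  have d: "ext_d (Suc k) J y = ext_d (Suc k) \<alpha> y" if "y \<in> U" for y
    using ext_d_diff[of J U "k + 1" \<alpha>] closed J \<alpha>_form that by (simp add: forms_eq_def fun_eq_iff)
  have "antiexact_part x0 (k + 1) J x v = \<alpha> x v" if x: "x \<in> U" for x v
  proof -
    have "antiexact_part x0 (k + 1) J x v = homotopy_op x0 (Suc (Suc k)) (ext_d (Suc k) \<alpha>) x v"
      unfolding antiexact_part_def add_Suc_right add_0_right One_nat_def homotopy_op_eq_radial_integral
      by (intro radial_integral_cong x) (simp add: d)
    then show ?thesis using homotopy_formula[of \<alpha> k x v] \<alpha>_form x by (simp add: dH0)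
  qed
  then show ?thesis by (simp add: forms_eq_def fun_eq_iff)
qed

lemma ext_d_sum3:
  assumes "\<phi>1 \<in> forms U k" and "\<phi>2 \<in> forms U k" and "\<phi>3 \<in> forms U k" and "x \<in> U"
  shows "ext_d k (\<phi>1 + \<phi>2 + \<phi>3) x = ext_d k \<phi>1 x + ext_d k (\<phi>2 + \<phi>3) x"
  using ext_d_add[of \<phi>1 U k "\<phi>2 + \<phi>3"] forms_add[OF open_domain, of \<phi>2 k \<phi>3] assms
  by (simp add: forms_eq_def add.assoc)

lemma cov_d_sum3:
  assumes "\<phi>1 \<in> forms U k" and "\<phi>2 \<in> forms U k" and "\<phi>3 \<in> wedge_ker U k A" and "x \<in> U"
  shows "cov_d k A (\<phi>1 + \<phi>2 + \<phi>3) x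
    = cov_d k A \<phi>1 x + ext_d k (\<phi>2 + \<phi>3) x + wedge1 k A \<phi>2 x"
proof -
  have "wedge1 k A \<phi>3 x = 0" "\<phi>3 \<in> forms U k"
    using assms(3,4) by (auto simp: wedge_ker_def forms_eq_def)
  then show ?thesis
    by (simp add: cov_d_def wedge1_add ext_d_sum3[OF assms(1,2) _ assms(4)])
qed

context
  fixes k :: nat and A :: "('a, 'v::euclidean_space \<Rightarrow>\<^sub>L 'v) form" and J :: "('a, 'v) form"
  assumes A: "A \<in> forms U 1" and J: "J \<in> forms U (k + 1)"
begin

text \<open>
  Subtracting the algebraic equation \<open>A \<and> \<phi>2 = H d J\<close> from \<open>d\<phi> + A \<and> \<phi> = J\<close> leaves the equation for
  \<open>\<phi>1\<close>, since \<open>J = d H J + H d J\<close> and \<open>A \<and> \<phi>3 = 0\<close>. So the component system is the original equation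
  for the sum, together with one algebraic equation for \<open>\<phi>2\<close>.
\<close>

lemma component_system_iff:
  "component_system U x0 k A J \<phi>1 \<phi>2 \<phi>3 \<longleftrightarrow>
    \<phi>1 \<in> forms U k \<and> \<phi>2 \<in> forms U k \<and> \<phi>3 \<in> wedge_ker U k A \<and>
    forms_eq U (cov_d k A (\<phi>1 + \<phi>2 + \<phi>3)) J \<and>
    forms_eq U (wedge1 k A \<phi>2) (antiexact_part x0 (k + 1) J)"
proof -
  have "cov_d k A (\<phi>1 + \<phi>2 + \<phi>3) x = J x \<longleftrightarrow>
      cov_d k A \<phi>1 x = exact_part x0 (k + 1) J x - ext_d k (\<phi>2 + \<phi>3) x"
    if \<phi>: "\<phi>1 \<in> forms U k" "\<phi>2 \<in> forms U k" "\<phi>3 \<in> wedge_ker U k A"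
      and w: "wedge1 k A \<phi>2 x = antiexact_part x0 (k + 1) J x" and x: "x \<in> U" for x
  proof -
    have "J x = exact_part x0 (k + 1) J x + antiexact_part x0 (k + 1) J x"
      using exact_part_plus_antiexact_part[OF J] x by (simp add: forms_eq_def)
    then show ?thesis unfolding cov_d_sum3[OF \<phi> x] w by (simp add: eq_diff_eq)
  qed
  then show ?thesis unfolding component_system_def forms_eq_def by (auto simp del: One_nat_def)
qed

text \<open>
  The equation for \<open>\<phi>1\<close> displays \<open>A \<and> \<phi>1\<close> as \<open>d H J - d\<phi>\<close>, a difference of exact forms; and
  \<open>A \<and> \<phi>2 = H d J\<close> lies in the image of \<open>H\<close>.
\<close>

lemma component_system_solves:
  assumes "component_system U x0 k A J \<phi>1 \<phi>2 \<phi>3"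
  shows "\<phi>1 + \<phi>2 + \<phi>3 \<in> forms U k"
    and "forms_eq U (cov_d k A (\<phi>1 + \<phi>2 + \<phi>3)) J"
    and "admissible_splitting U x0 k A \<phi>1 \<phi>2 \<phi>3"
proof -
  have \<phi>: "\<phi>1 \<in> forms U k" "\<phi>2 \<in> forms U k" "\<phi>3 \<in> wedge_ker U k A"
    and eq1: "forms_eq U (cov_d k A \<phi>1) (exact_part x0 (k + 1) J - ext_d k (\<phi>2 + \<phi>3))"
    and eq2: "forms_eq U (wedge1 k A \<phi>2) (antiexact_part x0 (k + 1) J)"
    using assms by (auto simp: component_system_def)
  have \<phi>3: "\<phi>3 \<in> forms U k" using \<phi>(3) by (simp add: wedge_ker_def)
  have sum: "\<phi>1 + \<phi>2 + \<phi>3 \<in> forms U k" using \<phi> \<phi>3 by (intro forms_add open_domain)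
  then show "\<phi>1 + \<phi>2 + \<phi>3 \<in> forms U k" .
  show "forms_eq U (cov_d k A (\<phi>1 + \<phi>2 + \<phi>3)) J" using assms by (simp add: component_system_iff)
  have dsum: "ext_d k (\<phi>1 + \<phi>2 + \<phi>3) \<in> forms U (k + 1)"
    using ext_d_in_forms[OF open_domain sum] by simp
  have w1: "forms_eq U (exact_part x0 (k + 1) J - ext_d k (\<phi>1 + \<phi>2 + \<phi>3)) (wedge1 k A \<phi>1)"
    using eq1 ext_d_sum3[OF \<phi>(1,2) \<phi>3] by (auto simp: forms_eq_def cov_d_def algebra_simps fun_eq_iff)
  have "forms_eq U (ext_d (k + 1) (exact_part x0 (k + 1) J - ext_d k (\<phi>1 + \<phi>2 + \<phi>3))) 0"
    using ext_d_diff[OF exact_part_in_forms[OF J] dsum] ext_d_exact_part[OF J] ext_d_ext_d[OF open_domain sum]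
    by (simp add: forms_eq_def fun_eq_iff)
  then have "forms_eq U (ext_d (k + 1) (wedge1 k A \<phi>1)) 0"
    using ext_d_cong[OF open_domain forms_diff[OF open_domain exact_part_in_forms[OF J] dsum] w1]
    by (simp add: forms_eq_def)
  moreover have "wedge1 k A \<phi>1 \<in> forms U (k + 1)" "wedge1 k A \<phi>2 \<in> forms U (k + 1)"
    using wedge1_in_forms[OF open_domain A] \<phi> by simp_all
  ultimately show "admissible_splitting U x0 k A \<phi>1 \<phi>2 \<phi>3"
    using eq2 antiexact_part_antiexact[OF J] \<phi> centre
    by (simp add: admissible_splitting_def exact_forms_def antiexact_forms_def forms_eq_def)
qed

text \<open>
  For such a splitting, \<open>J - A \<and> \<phi>2 = d\<phi> + A \<and> \<phi>1\<close> is closed and \<open>A \<and> \<phi>2\<close> is antiexact. Uniqueness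
  of the antiexact part forces \<open>A \<and> \<phi>2 = H d J\<close>.
\<close>

lemma admissible_solution_component_system:
  assumes split: "admissible_splitting U x0 k A \<phi>1 \<phi>2 \<phi>3"
    and eq: "forms_eq U (cov_d k A (\<phi>1 + \<phi>2 + \<phi>3)) J"
  shows "component_system U x0 k A J \<phi>1 \<phi>2 \<phi>3"
proof -
  have \<phi>: "\<phi>1 \<in> forms U k" "\<phi>2 \<in> forms U k" "\<phi>3 \<in> wedge_ker U k A"
    and w1: "wedge1 k A \<phi>1 \<in> forms U (k + 1)" "forms_eq U (ext_d (k + 1) (wedge1 k A \<phi>1)) 0"
    and w2: "wedge1 k A \<phi>2 \<in> antiexact_forms U x0 (k + 1)"
    using split by (auto simp: admissible_splitting_def exact_forms_def)
  have \<phi>3: "\<phi>3 \<in> forms U k" using \<phi>(3) by (simp add: wedge_ker_def)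
  have sum: "\<phi>1 + \<phi>2 + \<phi>3 \<in> forms U k" using \<phi> \<phi>3 by (intro forms_add open_domain)
  have dsum: "ext_d k (\<phi>1 + \<phi>2 + \<phi>3) \<in> forms U (k + 1)"
    using ext_d_in_forms[OF open_domain sum] by simp
  have "forms_eq U (ext_d k (\<phi>1 + \<phi>2 + \<phi>3) + wedge1 k A \<phi>1) (J - wedge1 k A \<phi>2)"
    using eq cov_d_sum3[OF \<phi>] ext_d_sum3[OF \<phi>(1,2) \<phi>3]
    by (auto simp: forms_eq_def cov_d_def fun_eq_iff algebra_simps)
  from ext_d_cong[OF open_domain forms_add[OF open_domain dsum w1(1)] this]
  have "forms_eq U (ext_d (k + 1) (J - wedge1 k A \<phi>2)) 0"
    using ext_d_add[OF dsum w1(1)] w1(2) ext_d_ext_d[OF open_domain sum]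
    by (simp add: forms_eq_def fun_eq_iff)
  from antiexact_part_unique[OF J w2 this] show ?thesis
    using \<phi> eq by (simp add: component_system_iff)
qed

text \<open>
  One solution \<open>\<phi>2\<close> of the algebraic equation serves for all solutions \<open>\<phi>\<close> and all choices of
  \<open>\<phi>3\<close>, because the equation left for the remainder depends on the sum only.
\<close>

lemma solution_component_system:
  assumes "\<phi> \<in> forms U k" and "\<phi>2 \<in> forms U k" and "\<phi>3 \<in> wedge_ker U k A"
    and "forms_eq U (wedge1 k A \<phi>2) (antiexact_part x0 (k + 1) J)"
  shows "forms_eq U (cov_d k A \<phi>) J \<longleftrightarrow> component_system U x0 k A J (\<phi> - \<phi>2 - \<phi>3) \<phi>2 \<phi>3"
proof -
  have "\<phi> - \<phi>2 - \<phi>3 \<in> forms U k"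
    using assms by (intro forms_diff open_domain) (auto simp: wedge_ker_def)
  moreover have "\<phi> - \<phi>2 - \<phi>3 + \<phi>2 + \<phi>3 = \<phi>" by (simp add: fun_eq_iff)
  ultimately show ?thesis using assms by (simp add: component_system_iff)
qed

lemma no_component_system_no_solution:
  assumes none: "\<nexists>\<phi>1 \<phi>2 \<phi>3. component_system U x0 k A J \<phi>1 \<phi>2 \<phi>3"
    and \<phi>: "\<phi> \<in> forms U k" "forms_eq U (cov_d k A \<phi>) J"
  shows "antiexact_part x0 (k + 1) J \<notin> wedge_im U k A"
    and "\<nexists>\<phi>1 \<phi>2 \<phi>3. admissible_splitting U x0 k A \<phi>1 \<phi>2 \<phi>3 \<and> forms_eq U \<phi> (\<phi>1 + \<phi>2 + \<phi>3)"
proof -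
  have zero: "0 \<in> wedge_ker U k A"
    using zero_in_forms[OF open_domain] by (auto simp: wedge_ker_def forms_eq_def wedge1_def fun_eq_iff)
  show "antiexact_part x0 (k + 1) J \<notin> wedge_im U k A"
    using solution_component_system[OF \<phi>(1) _ zero] none \<phi>(2) by (auto simp: wedge_im_def)
  show "\<nexists>\<phi>1 \<phi>2 \<phi>3. admissible_splitting U x0 k A \<phi>1 \<phi>2 \<phi>3 \<and> forms_eq U \<phi> (\<phi>1 + \<phi>2 + \<phi>3)"
  proof clarify
    fix \<phi>1 \<phi>2 \<phi>3
    assume split: "admissible_splitting U x0 k A \<phi>1 \<phi>2 \<phi>3" and eq: "forms_eq U \<phi> (\<phi>1 + \<phi>2 + \<phi>3)"
    have "forms_eq U (cov_d k A (\<phi>1 + \<phi>2 + \<phi>3)) J"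
      using \<phi>(2) ext_d_cong[OF open_domain \<phi>(1) eq] eq by (auto simp: forms_eq_def cov_d_def wedge1_def fun_eq_iff)
    from admissible_solution_component_system[OF split this] none show False by blast
  qed
qed

end

end

theorem theorem4:
  fixes U :: "(real ^ 'n) set" and x0 :: "real ^ 'n" and k :: nat
    and A :: "(real ^ 'n, 'v::euclidean_space \<Rightarrow>\<^sub>L 'v) form" and J :: "(real ^ 'n, 'v) form"
  assumes "open U" and "bounded U" and "x0 \<in> U" and "\<forall>x\<in>U. closed_segment x0 x \<subseteq> U"
    and "k > 0"
    and "A \<in> forms U 1" and "constant_rank U A"
    and "J \<in> forms U (k + 1)"
  shows
    "(\<forall>\<phi>1 \<phi>2 \<phi>3. component_system U x0 k A J \<phi>1 \<phi>2 \<phi>3 \<longrightarrow>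
        \<phi>1 + \<phi>2 + \<phi>3 \<in> forms U k \<and> forms_eq U (cov_d k A (\<phi>1 + \<phi>2 + \<phi>3)) J \<and>
        wedge1 k A \<phi>1 \<in> exact_forms U (k + 1) \<and>
        wedge1 k A \<phi>2 \<in> antiexact_forms U x0 (k + 1))
   \<and> (\<forall>\<phi>1 \<phi>2 \<phi>3. admissible_splitting U x0 k A \<phi>1 \<phi>2 \<phi>3 \<longrightarrow>
        forms_eq U (cov_d k A (\<phi>1 + \<phi>2 + \<phi>3)) J \<longrightarrow> component_system U x0 k A J \<phi>1 \<phi>2 \<phi>3)
   \<and> ((\<nexists>\<phi>1 \<phi>2 \<phi>3. component_system U x0 k A J \<phi>1 \<phi>2 \<phi>3) \<longrightarrow>
        (\<nexists>\<phi>. \<phi> \<in> forms U k \<and> forms_eq U (cov_d k A \<phi>) J \<and>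
          (antiexact_part x0 (k + 1) J \<in> wedge_im U k A \<or>
           (\<exists>\<phi>1 \<phi>2 \<phi>3. admissible_splitting U x0 k A \<phi>1 \<phi>2 \<phi>3 \<and> forms_eq U \<phi> (\<phi>1 + \<phi>2 + \<phi>3)))))
   \<and> (\<forall>\<phi>2\<in>forms U k. \<forall>\<phi>3\<in>wedge_ker U k A.
        forms_eq U (wedge1 k A \<phi>2) (antiexact_part x0 (k + 1) J) \<longrightarrow>
        (\<forall>\<phi>\<in>forms U k. forms_eq U (cov_d k A \<phi>) J \<longleftrightarrow>
           component_system U x0 k A J (\<phi> - \<phi>2 - \<phi>3) \<phi>2 \<phi>3))
   \<and> ((\<exists>\<phi>2\<in>forms U k. forms_eq U (wedge1 k A \<phi>2) (antiexact_part x0 (k + 1) J)) \<longleftrightarrow>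
        antiexact_part x0 (k + 1) J \<in> wedge_im U k A)"
proof -
  interpret star_domain U x0
    using assms by unfold_locales auto
  note A = \<open>A \<in> forms U 1\<close> and J = \<open>J \<in> forms U (k + 1)\<close>
  have "antiexact_part x0 (k + 1) J \<in> forms U (k + 1)"
    using antiexact_part_antiexact[OF J] by (simp add: antiexact_forms_def)
  then have image: "(\<exists>\<phi>2\<in>forms U k. forms_eq U (wedge1 k A \<phi>2) (antiexact_part x0 (k + 1) J)) \<longleftrightarrow>
        antiexact_part x0 (k + 1) J \<in> wedge_im U k A"
    by (simp add: wedge_im_def)
  show ?thesis
  proof (intro conjI image)
    show "\<forall>\<phi>1 \<phi>2 \<phi>3. component_system U x0 k A J \<phi>1 \<phi>2 \<phi>3 \<longrightarrow>
        \<phi>1 + \<phi>2 + \<phi>3 \<in> forms U k \<and> forms_eq U (cov_d k A (\<phi>1 + \<phi>2 + \<phi>3)) J \<and>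
        wedge1 k A \<phi>1 \<in> exact_forms U (k + 1) \<and>
        wedge1 k A \<phi>2 \<in> antiexact_forms U x0 (k + 1)"
      using component_system_solves[OF A J] unfolding admissible_splitting_def by blast
    show "\<forall>\<phi>1 \<phi>2 \<phi>3. admissible_splitting U x0 k A \<phi>1 \<phi>2 \<phi>3 \<longrightarrow>
        forms_eq U (cov_d k A (\<phi>1 + \<phi>2 + \<phi>3)) J \<longrightarrow> component_system U x0 k A J \<phi>1 \<phi>2 \<phi>3"
      using admissible_solution_component_system[OF A J] by blast
    show "(\<nexists>\<phi>1 \<phi>2 \<phi>3. component_system U x0 k A J \<phi>1 \<phi>2 \<phi>3) \<longrightarrow>
        (\<nexists>\<phi>. \<phi> \<in> forms U k \<and> forms_eq U (cov_d k A \<phi>) J \<and>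
          (antiexact_part x0 (k + 1) J \<in> wedge_im U k A \<or>
           (\<exists>\<phi>1 \<phi>2 \<phi>3. admissible_splitting U x0 k A \<phi>1 \<phi>2 \<phi>3 \<and> forms_eq U \<phi> (\<phi>1 + \<phi>2 + \<phi>3))))"
      using no_component_system_no_solution[OF A J] by blast
    show "\<forall>\<phi>2\<in>forms U k. \<forall>\<phi>3\<in>wedge_ker U k A.
        forms_eq U (wedge1 k A \<phi>2) (antiexact_part x0 (k + 1) J) \<longrightarrow>
        (\<forall>\<phi>\<in>forms U k. forms_eq U (cov_d k A \<phi>) J \<longleftrightarrow>
           component_system U x0 k A J (\<phi> - \<phi>2 - \<phi>3) \<phi>2 \<phi>3)"
      using solution_component_system[OF A J] by blast
  qed
qed

end
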